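(* There exist a set $U\subseteq\mathbb N$ with $U\leq_T\emptyset''$ and a sequence $(U_e)_{e\in\mathbb N}$ of subsets of $\mathbb N$ such that: (i) $U_0=U$, and $(U_e)_{e\in\mathbb N}$ is a weak dyadic tower, i.e. $U_e\equiv_1 2U_{e+1}$ for every $e\in\mathbb N$; (ii) $U$ is noncomputable and is not a cylinder; (iii) every $U_e$ has computable reservoirs of both colours; (iv) $(U,(U_e)_{e\in\mathbb N})$ has the base absorption property, i.e. for every $X\leq_1 U$ there are $e\in\mathbb N$ and $m\geq1$ with $U\oplus X\equiv_1 mU_e$. More precisely, there is an $\emptyset''$-computable list $(\varphi_e)_{e\in\mathbb N}$ consisting entirely of total computable injections from $\mathbb N$ to $\mathbb N$ and containing every such injection, possibly with repetitions, such that, for every $e\in\mathbb N$, there is $k_e\in\{0,\ldots,2^e\}$ satisfying \[ U\oplus\varphi_e^{-1}(U)\equiv_1(2^e+k_e)U_e . \]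
   Context: All sets are subsets of $\mathbb N=\{0,1,2,\ldots\}$; $\leq_T$ is Turing reducibility and $\emptyset''$ is the second Turing jump of the empty set. $A\leq_1B$ means there is a total computable injection $f:\mathbb N\to\mathbb N$ with $x\in A\iff f(x)\in B$ for all $x$; $A\equiv_1B$ means $A\leq_1B$ and $B\leq_1A$. For each $m\geq1$ fix a computable bijection $\langle\cdot,\cdot\rangle_m:\{0,\ldots,m-1\}\times\mathbb N\to\mathbb N$ with computable inverse, and fix a computable bijection $\langle\cdot,\cdot\rangle:\mathbb N\times\mathbb N\to\mathbb N$. The $m$-fold autojoin of $A$ is $mA=\{\langle i,x\rangle_m: i<m,\ x\in A\}$, and the binary join is $A\oplus B=\{\langle0,x\rangle_2:x\in A\}\cup\{\langle1,x\rangle_2:x\in B\}$. The cylinder over $A$ is $\mathrm{Cyl}(A)=\{\langle x,t\rangle: x\in A,\ t\in\mathbb N\}$; $A$ is a cylinder if $A\equiv_1\mathrm{Cyl}(A)$. $A$ has computable reservoirs of both colours if there are computable infinite sets $R_1\subseteq A$ and $R_0\subseteq\mathbb N\setminus A$. No uniform procedure producing indices of the equivalences in the definition of a weak dyadic tower is assumed. An $\emptyset''$-computable list of computable functions is one for which an $\emptyset''$-computable function maps each $e$ to an ordinary index (in a fixed standard enumeration of the partial computable functions) of the $e$-th function. *)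

theory Defs
  imports "HOL-Library.Nat_Bijection"
begin

section \<open>Oracle computability\<close>

text \<open>
  Programs for unary partial functions on the natural numbers, relative to a set oracle.
  Several arguments are passed through the Cantor pairing \<^const>\<open>prod_encode\<close>.
\<close>

datatype prog =
    PZero | PSucc | PFst | PSnd | POracle
  | PPair prog prog | PComp prog prog | PRec prog prog | PMu prog

primrec run :: "nat set \<Rightarrow> prog \<Rightarrow> nat \<Rightarrow> nat option" where
  "run A PZero = (\<lambda>x. Some 0)"
| "run A PSucc = (\<lambda>x. Some (Suc x))"
| "run A PFst = (\<lambda>x. Some (fst (prod_decode x)))"
| "run A PSnd = (\<lambda>x. Some (snd (prod_decode x)))"
| "run A POracle = (\<lambda>x. Some (if x \<in> A then 1 else 0))"
| "run A (PPair p q) = (\<lambda>x. Option.bind (run A p x) (\<lambda>a.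
     Option.bind (run A q x) (\<lambda>b. Some (prod_encode (a, b)))))"
| "run A (PComp p q) = (\<lambda>x. Option.bind (run A q x) (run A p))"
| "run A (PRec p q) = (\<lambda>x. case prod_decode x of (a, n) \<Rightarrow>
     rec_nat (run A p a)
       (\<lambda>k r. Option.bind r (\<lambda>v. run A q (prod_encode (a, prod_encode (k, v))))) n)"
| "run A (PMu p) = (\<lambda>x.
     if \<exists>k. run A p (prod_encode (x, k)) = Some 0 \<and>
            (\<forall>j<k. run A p (prod_encode (x, j)) \<noteq> None)
     then Some (LEAST k. run A p (prod_encode (x, k)) = Some 0)
     else None)"

primrec prog_index :: "prog \<Rightarrow> nat" where
  "prog_index PZero = 0"
| "prog_index PSucc = 1"
| "prog_index PFst = 2"
| "prog_index PSnd = 3"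
| "prog_index POracle = 4"
| "prog_index (PPair p q) = 5 + 4 * prod_encode (prog_index p, prog_index q)"
| "prog_index (PComp p q) = 6 + 4 * prod_encode (prog_index p, prog_index q)"
| "prog_index (PRec p q) = 7 + 4 * prod_encode (prog_index p, prog_index q)"
| "prog_index (PMu p) = 8 + 4 * prog_index p"

lemma prog_index_inject: "prog_index p = prog_index q \<Longrightarrow> p = q"
proof (induction p arbitrary: q)
  case (PPair p1 p2) then show ?case by (cases q) (auto, presburger+)
next
  case (PComp p1 p2) then show ?case by (cases q) (auto, presburger+)
next
  case (PRec p1 p2) then show ?case by (cases q) (auto, presburger+)
next
  case (PMu p) then show ?case by (cases q) (auto, presburger+)
qed (case_tac q; simp)+

lemma prog_index_surj: "\<exists>p. prog_index p = n"
proof (induction n rule: less_induct)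
  case (less n)
  show ?case
  proof (cases "n < 5")
    case True
    then have "n = 0 \<or> n = 1 \<or> n = 2 \<or> n = 3 \<or> n = 4" by auto
    then show ?thesis using prog_index.simps(1-5) by metis
  next
    case False
    define m where "m = (n - 5) div 4"
    obtain a b where ab: "m = prod_encode (a, b)"
      by (metis prod_decode_inverse surj_pair)
    have "m < n" using False by (simp add: m_def)
    then have "a < n" "b < n"
      using le_prod_encode_1[of a b] le_prod_encode_2[of b a] by (auto simp: ab)
    then obtain p q r where
      "prog_index p = a" "prog_index q = b" "prog_index r = m"
      using less \<open>m < n\<close> by metis
    moreover have "n = 5 + 4 * m \<or> n = 6 + 4 * m \<or> n = 7 + 4 * m \<or> n = 8 + 4 * m"
      using False unfolding m_def by presburger
    ultimately show ?thesis
      using ab prog_index.simps(6-9) by metis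
  qed
qed

lemma bij_prog_index: "bij prog_index"
  by (metis bijI injI prog_index_inject prog_index_surj surj_def)

text \<open>The \<open>e\<close>-th partial function computable in \<open>A\<close>; for \<open>A = {}\<close> this is the
  standard enumeration of the partial computable functions.\<close>

definition phi :: "nat set \<Rightarrow> nat \<Rightarrow> nat \<Rightarrow> nat option" where
  "phi A e = run A (inv prog_index e)"

definition computable_in :: "nat set \<Rightarrow> (nat \<Rightarrow> nat) \<Rightarrow> bool" where
  "computable_in A f \<longleftrightarrow> (\<exists>e. phi A e = (\<lambda>x. Some (f x)))"

abbreviation computable :: "(nat \<Rightarrow> nat) \<Rightarrow> bool" where
  "computable f \<equiv> computable_in {} f"

definition turing_le :: "nat set \<Rightarrow> nat set \<Rightarrow> bool"  (infix "\<le>\<^sub>T" 50) where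
  "A \<le>\<^sub>T B \<longleftrightarrow> computable_in B (\<lambda>x. if x \<in> A then 1 else 0)"

definition computable_set :: "nat set \<Rightarrow> bool" where
  "computable_set A \<longleftrightarrow> computable (\<lambda>x. if x \<in> A then 1 else 0)"

definition jump :: "nat set \<Rightarrow> nat set" where
  "jump A = {e. phi A e e \<noteq> None}"

section \<open>One-one reducibility, joins and cylinders\<close>

definition one_le :: "nat set \<Rightarrow> nat set \<Rightarrow> bool"  (infix "\<le>\<^sub>1" 50) where
  "A \<le>\<^sub>1 B \<longleftrightarrow> (\<exists>f. computable f \<and> inj f \<and> (\<forall>x. x \<in> A \<longleftrightarrow> f x \<in> B))"

definition one_equiv :: "nat set \<Rightarrow> nat set \<Rightarrow> bool"  (infix "\<equiv>\<^sub>1" 50) where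
  "A \<equiv>\<^sub>1 B \<longleftrightarrow> A \<le>\<^sub>1 B \<and> B \<le>\<^sub>1 A"

text \<open>The computable bijection \<open>{0, ..., m-1} \<times> \<nat> \<rightarrow> \<nat>\<close>; its inverse is
  \<open>n \<mapsto> (n mod m, n div m)\<close>.\<close>

definition mpair :: "nat \<Rightarrow> nat \<Rightarrow> nat \<Rightarrow> nat" where
  "mpair m i x = i + m * x"

lemma bij_betw_mpair:
  assumes "m \<ge> 1"
  shows "bij_betw (\<lambda>(i, x). mpair m i x) ({..<m} \<times> UNIV) UNIV"
  by (rule bij_betw_byWitness[where f' = "\<lambda>n. (n mod m, n div m)"])
     (use assms in \<open>auto simp: mpair_def\<close>)

definition autojoin :: "nat \<Rightarrow> nat set \<Rightarrow> nat set" where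
  "autojoin m A = {mpair m i x | i x. i < m \<and> x \<in> A}"

definition join :: "nat set \<Rightarrow> nat set \<Rightarrow> nat set"  (infixl "\<oplus>" 65) where
  "A \<oplus> B = {mpair 2 0 x | x. x \<in> A} \<union> {mpair 2 1 x | x. x \<in> B}"

definition Cyl :: "nat set \<Rightarrow> nat set" where
  "Cyl A = {prod_encode (x, t) | x t. x \<in> A}"

definition is_cylinder :: "nat set \<Rightarrow> bool" where
  "is_cylinder A \<longleftrightarrow> A \<equiv>\<^sub>1 Cyl A"

definition computable_reservoirs :: "nat set \<Rightarrow> bool" where
  "computable_reservoirs A \<longleftrightarrow>
     (\<exists>R1 R0. computable_set R1 \<and> infinite R1 \<and> R1 \<subseteq> A \<and>
              computable_set R0 \<and> infinite R0 \<and> R0 \<subseteq> - A)"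

definition weak_dyadic_tower :: "(nat \<Rightarrow> nat set) \<Rightarrow> bool" where
  "weak_dyadic_tower Us \<longleftrightarrow> (\<forall>e. Us e \<equiv>\<^sub>1 autojoin 2 (Us (Suc e)))"

definition base_absorption :: "nat set \<Rightarrow> (nat \<Rightarrow> nat set) \<Rightarrow> bool" where
  "base_absorption U Us \<longleftrightarrow>
     (\<forall>X. X \<le>\<^sub>1 U \<longrightarrow> (\<exists>e m. m \<ge> 1 \<and> U \<oplus> X \<equiv>\<^sub>1 autojoin m (Us e)))"

text \<open>The function \<open>g\<close> below yields ordinary (oracle-free) indices; only \<open>g\<close> itself uses
  the oracle \<open>A\<close>.\<close>

definition computable_list_in :: "nat set \<Rightarrow> (nat \<Rightarrow> nat \<Rightarrow> nat) \<Rightarrow> bool" where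
  "computable_list_in A F \<longleftrightarrow>
     (\<exists>g. computable_in A g \<and> (\<forall>e. phi {} (g e) = (\<lambda>x. Some (F e x))))"

end

theory Submission
  imports Defs
begin

text \<open>
  The sets \<open>U\<^sub>e\<close> arise from computable maps \<open>d\<^sub>e\<close> with \<open>U\<^sub>e = d\<^sub>e\<^sup>-\<^sup>1(U\<^sub>e\<^sub>+\<^sub>1)\<close>. Each \<open>d\<^sub>e\<close> fixes the
  coloured points \<open>0\<close> (out) and \<open>1\<close> (in), has infinite fibres over them and fibres of size two over
  every other point, and decreases every \<open>j \<ge> 2\<close>, so that every number is coloured eventually.
  With reservoirs available, the fibre sizes of a computable \<open>h\<close> over \<open>j \<ge> 2\<close> determine
  \<open>h\<^sup>-\<^sup>1(B)\<close> up to one-one equivalence.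

  Let \<open>c\<close> be the composition of the earlier maps, \<open>\<phi>\<close> the next injection and \<open>q = c \<circ> \<phi>\<close>. Let \<open>k\<close> be
  the limit superior of the fibre sizes of \<open>q\<close>. Beyond some \<open>N\<close> no fibre exceeds \<open>k\<close>, so a
  computable set \<open>Y\<close> of points with fibre size exactly \<open>k\<close> can be enumerated; \<open>d\<^sub>e\<close> merges half of
  \<open>Y\<close> in pairs and colours everything else, which makes the fibre sizes of \<open>d\<^sub>e \<circ> c \<circ> \<phi>\<close> over
  \<open>j \<ge> 2\<close> constant. Colouring two coordinates outside \<open>Y\<close> differently prevents \<open>\<phi>\<close> from reducing
  the cylinder over \<open>U\<close> to \<open>U\<close>. That \<open>(k, N)\<close> is correct is a \<open>\<Pi>\<^sub>2\<close> property of indices, hence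
  decidable from the second jump.
\<close>

section \<open>Uniform computability relative to function oracles\<close>

abbreviation pi1 :: "nat \<Rightarrow> nat" where "pi1 x \<equiv> fst (prod_decode x)"
abbreviation pi2 :: "nat \<Rightarrow> nat" where "pi2 x \<equiv> snd (prod_decode x)"

text \<open>The relativised semantics with a function as oracle: substituting a program for
  \<^const>\<open>POracle\<close> then turns uniform computability in an oracle into a computable map on indices.\<close>

primrec runf :: "(nat \<Rightarrow> nat) \<Rightarrow> prog \<Rightarrow> nat \<Rightarrow> nat option" where
  "runf f PZero = (\<lambda>x. Some 0)"
| "runf f PSucc = (\<lambda>x. Some (Suc x))"
| "runf f PFst = (\<lambda>x. Some (pi1 x))"
| "runf f PSnd = (\<lambda>x. Some (pi2 x))"
| "runf f POracle = (\<lambda>x. Some (f x))"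
| "runf f (PPair p q) = (\<lambda>x. Option.bind (runf f p x) (\<lambda>a.
     Option.bind (runf f q x) (\<lambda>b. Some (prod_encode (a, b)))))"
| "runf f (PComp p q) = (\<lambda>x. Option.bind (runf f q x) (runf f p))"
| "runf f (PRec p q) = (\<lambda>x. case prod_decode x of (a, n) \<Rightarrow>
     rec_nat (runf f p a)
       (\<lambda>k r. Option.bind r (\<lambda>v. runf f q (prod_encode (a, prod_encode (k, v))))) n)"
| "runf f (PMu p) = (\<lambda>x.
     if \<exists>k. runf f p (prod_encode (x, k)) = Some 0 \<and>
            (\<forall>j<k. runf f p (prod_encode (x, j)) \<noteq> None)
     then Some (LEAST k. runf f p (prod_encode (x, k)) = Some 0)
     else None)"

abbreviation ind :: "nat set \<Rightarrow> nat \<Rightarrow> nat" where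
  "ind A \<equiv> (\<lambda>x. of_bool (x \<in> A))"

lemma run_eq_runf: "run A p = runf (ind A) p"
  by (induction p) (simp_all add: of_bool_def cong: if_cong)

text \<open>One program serves every oracle in \<open>S\<close>, and its behaviour on other oracles
  is unconstrained. This uniformity later yields computable maps on indices.\<close>

definition recursive_on :: "(nat \<Rightarrow> nat) set \<Rightarrow> ((nat \<Rightarrow> nat) \<Rightarrow> nat \<Rightarrow> nat) \<Rightarrow> bool" where
  "recursive_on S F \<longleftrightarrow> (\<exists>p. \<forall>f\<in>S. \<forall>x. runf f p x = Some (F f x))"

definition decidable_on :: "(nat \<Rightarrow> nat) set \<Rightarrow> ((nat \<Rightarrow> nat) \<Rightarrow> nat \<Rightarrow> bool) \<Rightarrow> bool" where
  "decidable_on S P \<longleftrightarrow> recursive_on S (\<lambda>f x. of_bool (P f x))"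

lemma phi_prog_index [simp]: "phi A (prog_index p) = run A p"
  by (simp add: phi_def inv_f_f bij_is_inj bij_prog_index)

lemma phi_program: obtains p where "prog_index p = e" "phi A e = run A p"
  by (metis phi_prog_index prog_index_surj)

lemma computable_in_iff: "computable_in A f \<longleftrightarrow> recursive_on {ind A} (\<lambda>_. f)"
proof
  assume "computable_in A f"
  then obtain e where "phi A e = (\<lambda>x. Some (f x))" by (auto simp: computable_in_def)
  then show "recursive_on {ind A} (\<lambda>_. f)"
    unfolding recursive_on_def using phi_program[of e A] by (metis run_eq_runf singletonD)
next
  assume "recursive_on {ind A} (\<lambda>_. f)"
  then obtain p where "\<And>x. runf (ind A) p x = Some (f x)" by (auto simp: recursive_on_def)
  then have "phi A (prog_index p) = (\<lambda>x. Some (f x))" by (auto simp: run_eq_runf)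
  then show "computable_in A f" unfolding computable_in_def by blast
qed

lemma turing_le_iff: "A \<le>\<^sub>T B \<longleftrightarrow> decidable_on {ind B} (\<lambda>_ x. x \<in> A)"
  by (simp add: turing_le_def computable_in_iff decidable_on_def of_bool_def)

lemma computable_set_iff: "computable_set A \<longleftrightarrow> decidable_on {ind {}} (\<lambda>_ x. x \<in> A)"
  by (simp add: computable_set_def computable_in_iff decidable_on_def of_bool_def)

lemma recursive_onI: "(\<And>f x. f \<in> S \<Longrightarrow> runf f p x = Some (F f x)) \<Longrightarrow> recursive_on S F"
  unfolding recursive_on_def by blast

lemma recursive_onE:
  assumes "recursive_on S F"
  obtains p where "\<And>f x. f \<in> S \<Longrightarrow> runf f p x = Some (F f x)"
  using assms unfolding recursive_on_def by blast

lemma recursive_on_cong: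
  "recursive_on S F \<Longrightarrow> (\<And>f x. f \<in> S \<Longrightarrow> F f x = G f x) \<Longrightarrow> recursive_on S G"
  unfolding recursive_on_def by simp

section \<open>Closure properties of uniform computability\<close>

primrec const_prog :: "nat \<Rightarrow> prog" where
  "const_prog 0 = PZero"
| "const_prog (Suc n) = PComp PSucc (const_prog n)"

lemma runf_const_prog [simp]: "runf f (const_prog n) x = Some n"
  by (induction n) auto

lemma recursive_on_const: "recursive_on S (\<lambda>f x. c)"
  by (rule recursive_onI[of _ "const_prog c"]) simp

definition id_prog :: prog where "id_prog = PPair PFst PSnd"

lemma runf_id_prog [simp]: "runf f id_prog x = Some x"
  by (simp add: id_prog_def)

lemma recursive_on_id: "recursive_on S (\<lambda>f x. x)"
  by (rule recursive_onI[of _ id_prog]) simp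

lemma recursive_on_comp:
  assumes "recursive_on S F" "recursive_on S G"
  shows "recursive_on S (\<lambda>f x. F f (G f x))"
proof -
  obtain p where p: "\<And>f x. f \<in> S \<Longrightarrow> runf f p x = Some (F f x)"
    using assms(1) by (rule recursive_onE) blast
  obtain q where q: "\<And>f x. f \<in> S \<Longrightarrow> runf f q x = Some (G f x)"
    using assms(2) by (rule recursive_onE) blast
  from p q show ?thesis by (intro recursive_onI[of _ "PComp p q"]) simp
qed

lemma recursive_on_oracle:
  assumes "recursive_on S G" shows "recursive_on S (\<lambda>f x. f (G f x))"
  by (rule recursive_on_comp[OF _ assms], rule recursive_onI[of _ POracle]) simp

lemma recursive_on_Suc:
  assumes "recursive_on S G" shows "recursive_on S (\<lambda>f x. Suc (G f x))"
  by (rule recursive_on_comp[OF _ assms], rule recursive_onI[of _ PSucc]) simp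

lemma recursive_on_pi1:
  assumes "recursive_on S G" shows "recursive_on S (\<lambda>f x. pi1 (G f x))"
  by (rule recursive_on_comp[OF _ assms], rule recursive_onI[of _ PFst]) simp

lemma recursive_on_pi2:
  assumes "recursive_on S G" shows "recursive_on S (\<lambda>f x. pi2 (G f x))"
  by (rule recursive_on_comp[OF _ assms], rule recursive_onI[of _ PSnd]) simp

lemma recursive_on_pair:
  assumes "recursive_on S F" "recursive_on S G"
  shows "recursive_on S (\<lambda>f x. prod_encode (F f x, G f x))"
proof -
  obtain p where p: "\<And>f x. f \<in> S \<Longrightarrow> runf f p x = Some (F f x)"
    using assms(1) by (rule recursive_onE) blast
  obtain q where q: "\<And>f x. f \<in> S \<Longrightarrow> runf f q x = Some (G f x)"
    using assms(2) by (rule recursive_onE) blast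
  from p q show ?thesis by (intro recursive_onI[of _ "PPair p q"]) simp
qed

lemma recursive_on_lift2:
  assumes "recursive_on S (\<lambda>f x. H f (pi1 x) (pi2 x))" "recursive_on S F" "recursive_on S G"
  shows "recursive_on S (\<lambda>f x. H f (F f x) (G f x))"
  using recursive_on_comp[OF assms(1) recursive_on_pair[OF assms(2,3)]] by simp

lemma recursive_on_rec:
  assumes "recursive_on S (\<lambda>f x. H f (pi1 x) (pi1 (pi2 x)) (pi2 (pi2 x)))"
    and "recursive_on S F" "recursive_on S G"
  shows "recursive_on S (\<lambda>f x. rec_nat (F f x) (\<lambda>k r. H f x k r) (G f x))"
proof -
  obtain p where p: "\<And>f x. f \<in> S \<Longrightarrow> runf f p x = Some (F f x)"
    using assms(2) by (rule recursive_onE) blast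
  obtain q where q: "\<And>f x. f \<in> S \<Longrightarrow>
      runf f q x = Some (H f (pi1 x) (pi1 (pi2 x)) (pi2 (pi2 x)))"
    using assms(1) by (rule recursive_onE) blast
  have "runf f (PRec p q) (prod_encode (x, n)) = Some (rec_nat (F f x) (H f x) n)"
    if "f \<in> S" for f x n
    using p[OF that] q[OF that] by (induction n) auto
  then have "recursive_on S (\<lambda>f x. rec_nat (F f (pi1 x)) (H f (pi1 x)) (pi2 x))"
    by (intro recursive_onI[of _ "PRec p q"]) (metis prod.collapse prod_decode_inverse)
  from recursive_on_comp[OF this recursive_on_pair[OF recursive_on_id assms(3)]]
  show ?thesis by simp
qed

lemma recursive_on_add:
  assumes "recursive_on S F" "recursive_on S G"
  shows "recursive_on S (\<lambda>f x. F f x + G f x)"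
proof -
  have "recursive_on S (\<lambda>f x. rec_nat (F f x) (\<lambda>k r. Suc r) (G f x))"
    by (intro recursive_on_rec recursive_on_Suc recursive_on_pi2 recursive_on_id assms)
  moreover have "rec_nat a (\<lambda>k r. Suc r) b = a + b" for a b :: nat by (induction b) auto
  ultimately show ?thesis by simp
qed

lemma recursive_on_mult:
  assumes "recursive_on S F" "recursive_on S G"
  shows "recursive_on S (\<lambda>f x. F f x * G f x)"
proof -
  have "recursive_on S (\<lambda>f x. rec_nat 0 (\<lambda>k r. r + F f x) (G f x))"
    by (intro recursive_on_rec recursive_on_add recursive_on_pi1 recursive_on_pi2
      recursive_on_id recursive_on_const assms recursive_on_comp[OF assms(1)])
  moreover have "rec_nat 0 (\<lambda>k r. r + a) b = a * b" for a b :: nat by (induction b) auto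
  ultimately show ?thesis by simp
qed

lemma recursive_on_diff:
  assumes "recursive_on S F" "recursive_on S G"
  shows "recursive_on S (\<lambda>f x. F f x - G f x)"
proof -
  have "recursive_on S (\<lambda>f x. rec_nat 0 (\<lambda>k r. k) x)"
    by (intro recursive_on_rec recursive_on_pi1 recursive_on_pi2
      recursive_on_id recursive_on_const)
  moreover have "rec_nat 0 (\<lambda>k r. k) b = b - 1" for b :: nat by (cases b) auto
  ultimately have pred: "recursive_on S (\<lambda>f x. x - 1)" by simp
  have "recursive_on S (\<lambda>f x. rec_nat (F f x) (\<lambda>k r. r - 1) (G f x))"
    by (intro recursive_on_rec recursive_on_comp[OF pred] recursive_on_pi2
      recursive_on_id assms)
  moreover have "rec_nat a (\<lambda>k r. r - 1) b = a - b" for a b :: nat by (induction b) auto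
  ultimately show ?thesis by simp
qed

lemma recursive_on_of_bool: "decidable_on S P \<Longrightarrow> recursive_on S (\<lambda>f x. of_bool (P f x))"
  by (simp add: decidable_on_def)

lemma recursive_on_if:
  assumes "decidable_on S P" "recursive_on S F" "recursive_on S G"
  shows "recursive_on S (\<lambda>f x. if P f x then F f x else G f x)"
proof -
  \<comment> \<open>A recursion of length 0 or 1 selects the branch.\<close>
  have "recursive_on S (\<lambda>f x. rec_nat (G f x) (\<lambda>k r. F f x) (of_bool (P f x)))"
    by (intro recursive_on_rec recursive_on_comp[OF assms(2)] recursive_on_pi1
      recursive_on_of_bool recursive_on_id assms)
  then show ?thesis by (rule recursive_on_cong) simp
qed

lemma decidable_on_not:
  assumes "decidable_on S P" shows "decidable_on S (\<lambda>f x. \<not> P f x)"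
proof -
  have "recursive_on S (\<lambda>f x. 1 - of_bool (P f x))"
    by (intro recursive_on_diff recursive_on_const recursive_on_of_bool assms)
  then show ?thesis unfolding decidable_on_def by (rule recursive_on_cong) auto
qed

lemma decidable_on_conj:
  assumes "decidable_on S P" "decidable_on S Q" shows "decidable_on S (\<lambda>f x. P f x \<and> Q f x)"
  unfolding decidable_on_def of_bool_conj
  by (intro recursive_on_mult recursive_on_of_bool assms)

lemma decidable_on_disj:
  assumes "decidable_on S P" "decidable_on S Q" shows "decidable_on S (\<lambda>f x. P f x \<or> Q f x)"
  using decidable_on_not[OF decidable_on_conj[OF decidable_on_not decidable_on_not]] assms
  by fastforce

lemma decidable_on_imp:
  assumes "decidable_on S P" "decidable_on S Q" shows "decidable_on S (\<lambda>f x. P f x \<longrightarrow> Q f x)"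
  unfolding imp_conv_disj by (intro decidable_on_disj decidable_on_not assms)

lemma decidable_on_le:
  assumes "recursive_on S F" "recursive_on S G" shows "decidable_on S (\<lambda>f x. F f x \<le> G f x)"
proof -
  have "recursive_on S (\<lambda>f x. 1 - (F f x - G f x))"
    by (intro recursive_on_diff recursive_on_const assms)
  then show ?thesis unfolding decidable_on_def by (rule recursive_on_cong) auto
qed

lemma decidable_on_less:
  assumes "recursive_on S F" "recursive_on S G" shows "decidable_on S (\<lambda>f x. F f x < G f x)"
  unfolding Suc_le_eq[symmetric] by (intro decidable_on_le recursive_on_Suc assms)

lemma decidable_on_eq:
  assumes "recursive_on S F" "recursive_on S G" shows "decidable_on S (\<lambda>f x. F f x = G f x)"
  unfolding order_eq_iff by (intro decidable_on_le decidable_on_conj assms)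

lemma decidable_on_comp:
  assumes "decidable_on S P" "recursive_on S G"
  shows "decidable_on S (\<lambda>f x. P f (G f x))"
  using recursive_on_comp[OF assms(1)[unfolded decidable_on_def] assms(2)]
  by (simp add: decidable_on_def)

text \<open>\<open>PMu\<close> searches for a zero, so it is applied to a program for the negated
  predicate; \<open>ex\<close> makes the search total.\<close>

lemma recursive_on_Least:
  assumes P: "decidable_on S (\<lambda>f x. P f (pi1 x) (pi2 x))"
    and ex: "\<And>f x. f \<in> S \<Longrightarrow> \<exists>k. P f x k"
  shows "recursive_on S (\<lambda>f x. LEAST k. P f x k)"
proof -
  obtain p where p: "\<And>f x. f \<in> S \<Longrightarrow> runf f p x = Some (of_bool (\<not> P f (pi1 x) (pi2 x)))"
    using decidable_on_not[OF P] unfolding decidable_on_def by (rule recursive_onE) blast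
  show ?thesis
    by (rule recursive_onI[of _ "PMu p"]) (use ex p in simp)
qed

lemma recursive_on_div:
  assumes "recursive_on S F" "recursive_on S G"
  shows "recursive_on S (\<lambda>f x. F f x div G f x)"
proof -
  \<comment> \<open>Division as a search. The disjunct for a zero divisor stops it at 0, in
    accordance with \<open>a div 0 = 0\<close>.\<close>
  have "recursive_on S (\<lambda>f x. LEAST k. G f x = 0 \<or> F f x < G f x * Suc k)"
  proof (rule recursive_on_Least)
    show "decidable_on S (\<lambda>f x. G f (pi1 x) = 0 \<or> F f (pi1 x) < G f (pi1 x) * Suc (pi2 x))"
      by (intro decidable_on_disj decidable_on_eq decidable_on_less recursive_on_mult
        recursive_on_Suc recursive_on_const recursive_on_pi1 recursive_on_pi2 recursive_on_id
        recursive_on_comp[OF assms(1)] recursive_on_comp[OF assms(2)])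
    show "\<exists>k. G f x = 0 \<or> F f x < G f x * Suc k" for f x
      by (metis dividend_less_times_div neq0_conv mult_Suc_right)
  qed
  moreover have "(LEAST k. b = 0 \<or> a < b * Suc k) = a div b" for a b :: nat
  proof (cases "b = 0")
    case False
    show ?thesis
    proof (rule Least_equality)
      show "b = 0 \<or> a < b * Suc (a div b)"
        using False dividend_less_times_div[of b a] by simp
      show "a div b \<le> y" if "b = 0 \<or> a < b * Suc y" for y
        using that False div_less_iff_less_mult[of b a "Suc y"] by (simp add: mult.commute)
    qed
  qed simp
  ultimately show ?thesis by simp
qed

lemma recursive_on_mod:
  assumes "recursive_on S F" "recursive_on S G"
  shows "recursive_on S (\<lambda>f x. F f x mod G f x)"
  unfolding minus_mult_div_eq_mod[symmetric]
  by (intro recursive_on_diff recursive_on_mult recursive_on_div assms)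

lemmas recursive_intros =
  recursive_on_const recursive_on_id recursive_on_oracle recursive_on_Suc recursive_on_pi1
  recursive_on_pi2 recursive_on_pair recursive_on_add recursive_on_mult recursive_on_diff
  recursive_on_div recursive_on_mod recursive_on_if recursive_on_of_bool recursive_on_rec
  decidable_on_not decidable_on_conj decidable_on_disj decidable_on_imp decidable_on_le
  decidable_on_less decidable_on_eq

section \<open>One-one equivalence from fibre counts\<close>

lemma mem_autojoin_iff:
  assumes "m \<ge> 1" shows "n \<in> autojoin m A \<longleftrightarrow> n div m \<in> A"
proof
  assume "n div m \<in> A"
  moreover have "n = mpair m (n mod m) (n div m)" by (simp add: mpair_def)
  ultimately show "n \<in> autojoin m A" unfolding autojoin_def using assms
    by (smt (verit, best) mem_Collect_eq mod_less_divisor less_le_trans zero_less_one)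
qed (use assms in \<open>auto simp: autojoin_def mpair_def\<close>)

lemma mem_join_iff: "n \<in> A \<oplus> B \<longleftrightarrow> (if n mod 2 = 0 then n div 2 \<in> A else n div 2 \<in> B)"
proof -
  have "n \<in> A \<oplus> B \<longleftrightarrow> (\<exists>x\<in>A. n = 2 * x) \<or> (\<exists>x\<in>B. n = 2 * x + 1)"
    unfolding join_def mpair_def by (simp only: Un_iff mem_Collect_eq) (use add.commute in force)
  also have "(\<exists>x\<in>A. n = 2 * x) \<longleftrightarrow> n mod 2 = 0 \<and> n div 2 \<in> A"
    by force
  also have "(\<exists>x\<in>B. n = 2 * x + 1) \<longleftrightarrow> n mod 2 \<noteq> 0 \<and> n div 2 \<in> B"
  proof (intro iffI conjI)
    have "n = 2 * (n div 2) + 1" if "n mod 2 \<noteq> 0" using that by presburger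
    then show "\<exists>x\<in>B. n = 2 * x + 1" if "n mod 2 \<noteq> 0 \<and> n div 2 \<in> B"
      using that by blast
  qed auto
  finally show ?thesis by simp
qed

lemma mem_Cyl_iff: "n \<in> Cyl A \<longleftrightarrow> pi1 n \<in> A"
proof -
  obtain x t where "n = prod_encode (x, t)" by (metis prod_decode_inverse surj_pair)
  then show ?thesis by (auto simp: Cyl_def)
qed

text \<open>An approximation from below to the size of the fibre over \<open>j\<close>, computable
  whenever \<open>h\<close> is; the size itself is only its limit as \<open>b\<close> grows.\<close>

definition count_below :: "(nat \<Rightarrow> nat) \<Rightarrow> nat \<Rightarrow> nat \<Rightarrow> nat" where
  "count_below h j b = card {x. x < b \<and> h x = j}"

lemma count_below_Suc: "count_below h j (Suc b) = count_below h j b + of_bool (h b = j)"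
proof -
  have "{x. x < Suc b \<and> h x = j} = {x. x < b \<and> h x = j} \<union> (if h b = j then {b} else {})"
    by (auto simp: less_Suc_eq)
  then show ?thesis by (auto simp: count_below_def)
qed

lemma count_below_mono: "b \<le> b' \<Longrightarrow> count_below h j b \<le> count_below h j b'"
  unfolding count_below_def by (rule card_mono) auto

lemma count_below_le_card:
  "finite (h -` {j}) \<Longrightarrow> count_below h j b \<le> card (h -` {j})"
  unfolding count_below_def by (rule card_mono) auto

text \<open>Any finite subset of the fibre lies below some \<open>b\<close>, so it has at most
  \<open>k\<close> elements; an infinite fibre would contain one with \<open>k + 1\<close>.\<close>

lemma finite_fibre_if_count_below_le:
  assumes "\<And>b. count_below h j b \<le> k"
  shows "finite (h -` {j})" "card (h -` {j}) \<le> k"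
proof -
  have *: "card F \<le> k" if F: "finite F" "F \<subseteq> h -` {j}" for F
  proof -
    obtain b where "\<forall>x\<in>F. x < b" using F(1) finite_nat_set_iff_bounded by blast
    then have "card F \<le> count_below h j b"
      unfolding count_below_def using F by (intro card_mono) auto
    with assms[of b] show ?thesis by simp
  qed
  show fin: "finite (h -` {j})"
  proof (rule ccontr)
    assume "infinite (h -` {j})"
    then obtain F where "finite F" "card F = Suc k" "F \<subseteq> h -` {j}"
      by (meson infinite_arbitrarily_large)
    with * show False by fastforce
  qed
  show "card (h -` {j}) \<le> k" using *[OF fin] by simp
qed

lemma count_below_eq_rec_nat:
  "count_below h j b = rec_nat 0 (\<lambda>x r. r + of_bool (h x = j)) b"
  by (induction b) (simp_all add: count_below_Suc, simp add: count_below_def)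

lemma recursive_on_count_below:
  assumes "recursive_on S h" "recursive_on S F" "recursive_on S G"
  shows "recursive_on S (\<lambda>f x. count_below (h f) (F f x) (G f x))"
  unfolding count_below_eq_rec_nat
  by (intro recursive_intros assms recursive_on_comp[OF assms(1)] recursive_on_comp[OF assms(2)])

text \<open>The position of \<open>x\<close> in the increasing order of its own fibre, so that
  \<open>h x\<close> and \<open>rank h x\<close> together determine \<open>x\<close>.\<close>

definition rank :: "(nat \<Rightarrow> nat) \<Rightarrow> nat \<Rightarrow> nat" where
  "rank h x = count_below h (h x) x"

lemma inj_on_rank: "inj_on (rank h) (h -` {j})"
proof -
  have "rank h x < rank h y" if "h x = j" "h y = j" "x < y" for x y
    using count_below_mono[of "Suc x" y h j] that by (simp add: rank_def count_below_Suc)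
  then show ?thesis
    by (intro linorder_inj_onI') fastforce
qed

lemma rank_less:
  assumes "finite (h -` {h x})" shows "rank h x < card (h -` {h x})"
  using count_below_le_card[OF assms, of "Suc x"] by (simp add: rank_def count_below_Suc)

text \<open>On a finite fibre the ranks are distinct and smaller than its cardinality, so by
  counting they take every smaller value.\<close>

lemma rank_surj:
  assumes "finite (h -` {j})" "r < card (h -` {j})" shows "\<exists>x. h x = j \<and> rank h x = r"
proof -
  have "rank h ` (h -` {j}) = {..<card (h -` {j})}"
    using rank_less[of h] assms by (intro card_subset_eq) (auto simp: card_image[OF inj_on_rank])
  moreover have "r \<in> {..<card (h -` {j})}" using assms(2) by simp
  ultimately have "r \<in> rank h ` (h -` {j})" by simp
  then show ?thesis by auto
qed

lemma recursive_on_rank: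
  assumes "recursive_on S h" "recursive_on S F"
  shows "recursive_on S (\<lambda>f x. rank (h f) (F f x))"
  unfolding rank_def
  by (intro recursive_on_count_below assms recursive_on_comp[OF assms(1)])

section \<open>Reservoirs and displacement\<close>

lemma infinite_computable_set_enum:
  assumes "computable_set R" "infinite R"
  obtains r where "computable r" "inj r" "range r \<subseteq> R"
proof -
  define r where "r n = rec_nat (LEAST k. k \<in> R) (\<lambda>n y. LEAST k. k > y \<and> k \<in> R) n" for n
  have R: "decidable_on {ind {}} (\<lambda>_ x. x \<in> R)" using assms(1) by (simp add: computable_set_iff)
  have ex: "\<exists>k. k > y \<and> k \<in> R" for y using assms(2) unfolding finite_nat_set_iff_bounded_le by (metis not_le)
  have "recursive_on {ind {}} (\<lambda>_ n. r n)"
    unfolding r_def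
    by (intro recursive_intros recursive_on_Least decidable_on_comp[OF R] ex)
       (use ex in blast)
  then have "computable r" by (simp add: computable_in_iff)
  moreover have step: "r n < r (Suc n) \<and> r (Suc n) \<in> R" for n
    using LeastI_ex[OF ex[of "r n"]] by (simp add: r_def)
  then have "strict_mono r" by (simp add: strict_mono_Suc_iff)
  moreover have "r n \<in> R" for n
  proof (cases n)
    case 0
    have "\<exists>k. k \<in> R" using ex by blast
    then show ?thesis using LeastI_ex[of "\<lambda>k. k \<in> R"] 0 by (simp add: r_def)
  qed (use step in simp)
  ultimately show thesis using that strict_mono_imp_inj_on by blast
qed

text \<open>Elements outside \<open>D\<close> are sent into the reservoirs of \<open>B\<close>; values of \<open>g\<close> that already
  lie in a reservoir are moved to its even half, so that injectivity survives.\<close>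

lemma one_le_displacement:
  assumes B: "computable_reservoirs B"
    and D: "computable_set D" and E: "computable_set E" and g: "computable g"
    and inj: "inj_on g D"
    and AD: "\<And>x. x \<in> D \<Longrightarrow> x \<in> A \<longleftrightarrow> g x \<in> B"
    and AE: "\<And>x. x \<notin> D \<Longrightarrow> x \<in> A \<longleftrightarrow> x \<in> E"
  shows "A \<le>\<^sub>1 B"
proof -
  obtain R1 R0 where R: "computable_set R1" "infinite R1" "R1 \<subseteq> B"
      "computable_set R0" "infinite R0" "R0 \<subseteq> - B"
    using B by (auto simp: computable_reservoirs_def)
  obtain r1 where r1: "computable r1" "inj r1" "range r1 \<subseteq> R1"
    using infinite_computable_set_enum[OF R(1,2)] .
  obtain r0 where r0: "computable r0" "inj r0" "range r0 \<subseteq> R0"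
    using infinite_computable_set_enum[OF R(4,5)] .
  define \<kappa> where "\<kappa> x = (if x \<in> D then 2 * g x else 2 * x + 1)" for x
  define C1 where "C1 x \<longleftrightarrow> x \<in> D \<and> g x \<in> R1 \<or> x \<notin> D \<and> x \<in> E" for x
  define C0 where "C0 x \<longleftrightarrow> x \<in> D \<and> g x \<in> R0 \<or> x \<notin> D \<and> x \<notin> E" for x
  define f where "f x = (if C1 x then r1 (\<kappa> x) else if C0 x then r0 (\<kappa> x) else g x)" for x
  have "recursive_on {ind {}} (\<lambda>_ x. f x)"
    unfolding f_def \<kappa>_def C1_def C0_def
    by (intro recursive_intros recursive_on_comp[OF g[unfolded computable_in_iff]]
      recursive_on_comp[OF r1(1)[unfolded computable_in_iff]]
      recursive_on_comp[OF r0(1)[unfolded computable_in_iff]]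
      decidable_on_comp[OF D[unfolded computable_set_iff]]
      decidable_on_comp[OF E[unfolded computable_set_iff]]
      decidable_on_comp[OF R(1)[unfolded computable_set_iff]]
      decidable_on_comp[OF R(4)[unfolded computable_set_iff]])
  then have "computable f" by (simp add: computable_in_iff)
  moreover have "inj f"
  proof (rule injI)
    have \<kappa>: "x = y" if "\<kappa> x = \<kappa> y" for x y
    proof -
      have "2 * a \<noteq> 2 * b + 1" "2 * b + 1 \<noteq> 2 * a" for a b :: nat by presburger+
      with that show ?thesis using inj by (auto simp: \<kappa>_def inj_on_def split: if_splits)
    qed
    have mem: "r1 n \<in> R1" "r0 n \<in> R0" "r1 n \<notin> R0" "r0 n \<notin> R1" for n
      using r1(3) r0(3) R(3,6) by blast+
    \<comment> \<open>The reservoirs are disjoint, so an image reveals which clause of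
      \<open>f\<close> produced it, and points with equal images can be compared within one
      clause.\<close>
    have cls: "f x \<in> R1 \<longleftrightarrow> C1 x" "f x \<in> R0 \<longleftrightarrow> \<not> C1 x \<and> C0 x" for x
      using mem by (auto simp: f_def C1_def C0_def)
    fix x y assume xy: "f x = f y"
    then have same: "C1 x \<longleftrightarrow> C1 y" "\<not> C1 x \<Longrightarrow> C0 x \<longleftrightarrow> C0 y" using cls by metis+
    consider "C1 x" | "\<not> C1 x" "C0 x" | "\<not> C1 x" "\<not> C0 x" by blast
    then show "x = y"
    proof cases
      case 1
      then have "r1 (\<kappa> x) = r1 (\<kappa> y)" using xy same by (simp add: f_def)
      then show ?thesis using r1(2) \<kappa> by (simp add: inj_eq)
    next
      case 2
      then have "r0 (\<kappa> x) = r0 (\<kappa> y)" using xy same by (simp add: f_def)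
      then show ?thesis using r0(2) \<kappa> by (simp add: inj_eq)
    next
      case 3
      then have "g x = g y" "x \<in> D" "y \<in> D"
        using xy same by (simp_all add: f_def) (auto simp: C0_def C1_def)
      then show ?thesis using inj by (simp add: inj_on_def)
    qed
  qed
  moreover have "x \<in> A \<longleftrightarrow> f x \<in> B" for x
  proof -
    have "r1 n \<in> B" "r0 n \<notin> B" for n using r1(3) r0(3) R(3,6) by blast+
    then show ?thesis using AD[of x] AE[of x] R(3,6) by (auto simp: f_def C1_def C0_def)
  qed
  ultimately show ?thesis unfolding one_le_def by blast
qed

text \<open>Infinity is asked of the preimages, which lets \<open>{1}\<close> and \<open>{0}\<close>
  serve as \<open>R1\<close> and \<open>R0\<close> when the fibres over these points are
  infinite.\<close>

lemma computable_reservoirs_vimage: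
  assumes h: "computable h" and fib: "infinite (h -` R1)" "infinite (h -` R0)"
    and "computable_set R1" "computable_set R0" "R1 \<subseteq> B" "R0 \<subseteq> - B"
  shows "computable_reservoirs (h -` B)"
proof -
  have "computable_set (h -` R)" if "computable_set R" for R
    using decidable_on_comp[OF that[unfolded computable_set_iff] h[unfolded computable_in_iff]]
    by (simp add: computable_set_iff)
  with assms show ?thesis unfolding computable_reservoirs_def
    by (intro exI[of _ "h -` R1"] exI[of _ "h -` R0"]) auto
qed

lemma infinite_vimage_surj: "surj h \<Longrightarrow> infinite R \<Longrightarrow> infinite (h -` R)"
  by (metis finite_imageI surj_image_vimage_eq)

lemma computable_div: "computable (\<lambda>n. n div m)"
  unfolding computable_in_iff by (intro recursive_intros)

lemma computable_reservoirs_autojoin: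
  assumes "computable_reservoirs B" "m \<ge> 1" shows "computable_reservoirs (autojoin m B)"
proof -
  have "(\<lambda>n. n div m) -` B = autojoin m B" using mem_autojoin_iff[OF assms(2)] by auto
  moreover have "surj (\<lambda>n. n div m)"
    using assms(2) by (intro surjI[of _ "\<lambda>n. n * m"]) auto
  ultimately show ?thesis
    using assms(1) computable_reservoirs_vimage[OF computable_div[of m]] infinite_vimage_surj
    unfolding computable_reservoirs_def by metis
qed

text \<open>The even half of the join carries a copy of the reservoirs of \<open>A\<close>.\<close>

lemma computable_reservoirs_join:
  assumes "computable_reservoirs A" shows "computable_reservoirs (A \<oplus> B)"
proof -
  have 1: "computable_set {n. n mod 2 = 0 \<and> n div 2 \<in> R}" if "computable_set R" for R
    unfolding computable_set_iff mem_Collect_eq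
    by (intro recursive_intros decidable_on_comp[OF that[unfolded computable_set_iff]])
  have 2: "infinite {n. n mod 2 = 0 \<and> n div 2 \<in> R}" if "infinite R" for R :: "nat set"
  proof
    assume "finite {n. n mod 2 = 0 \<and> n div 2 \<in> R}"
    then have "finite ((\<lambda>n. n div 2) ` {n. n mod 2 = 0 \<and> n div 2 \<in> R})" by simp
    moreover have "R \<subseteq> (\<lambda>n. n div 2) ` {n. n mod 2 = 0 \<and> n div 2 \<in> R}"
      by (intro subsetI image_eqI[of _ _ "2 * _"]) auto
    ultimately show False using that finite_subset by blast
  qed
  obtain R1 R0 where R: "computable_set R1" "infinite R1" "R1 \<subseteq> A"
      "computable_set R0" "infinite R0" "R0 \<subseteq> - A"
    using assms by (auto simp: computable_reservoirs_def)
  show ?thesis unfolding computable_reservoirs_def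
    by (intro exI[of _ "{n. n mod 2 = 0 \<and> n div 2 \<in> R1}"]
        exI[of _ "{n. n mod 2 = 0 \<and> n div 2 \<in> R0}"] conjI 1 2 R)
       (use R in \<open>auto simp: mem_join_iff\<close>)
qed

text \<open>Over coordinates \<open>j \<ge> 2\<close>, the map sending \<open>x\<close> to
  \<open>h x\<close> and \<open>rank h x\<close> matches the fibres with the \<open>m\<close> copies
  of \<open>j\<close>. All other points lie over 0 or 1, where the colour is known, and can be
  displaced into reservoirs.\<close>

lemma one_equiv_autojoin_if_fibres:
  assumes h: "computable h" and A: "A = h -` B" and B01: "0 \<notin> B" "1 \<in> B"
    and resA: "computable_reservoirs A" and resB: "computable_reservoirs B"
    and m: "m \<ge> 1" and fib: "\<And>j. j \<ge> 2 \<Longrightarrow> card (h -` {j}) = m"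
  shows "A \<equiv>\<^sub>1 autojoin m B"
proof -
  note hr = recursive_on_comp[OF h[unfolded computable_in_iff]]
  have fin: "finite (h -` {j})" if "j \<ge> 2" for j
    using fib[OF that] m by (metis card.infinite not_one_le_zero)
  have rank_lt: "rank h x < m" if "h x \<ge> 2" for x
    using rank_less[OF fin[OF that]] fib[OF that] by simp
  have rr: "recursive_on {ind {}} (\<lambda>_ x. rank h (F x))" if "recursive_on {ind {}} (\<lambda>_. F)" for F
    using recursive_on_rank[OF h[unfolded computable_in_iff] that] .
  have small: "n < 2 \<Longrightarrow> n = 0 \<or> n = 1" for n :: nat by auto
  have "A \<le>\<^sub>1 autojoin m B"
  proof (rule one_le_displacement[where D = "{x. 2 \<le> h x}" and E = "{x. h x = 1}"
        and g = "\<lambda>x. rank h x + m * h x"])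
    show "computable_reservoirs (autojoin m B)" by (rule computable_reservoirs_autojoin) fact+
    show "computable_set {x. 2 \<le> h x}" "computable_set {x. h x = 1}"
      unfolding computable_set_iff mem_Collect_eq by (intro recursive_intros hr)+
    show "computable (\<lambda>x. rank h x + m * h x)"
      unfolding computable_in_iff by (intro recursive_intros hr rr)
    have div: "(rank h x + m * h x) div m = h x" if "2 \<le> h x" for x
      using rank_lt[OF that] m by simp
    show "inj_on (\<lambda>x. rank h x + m * h x) {x. 2 \<le> h x}"
    proof (rule inj_onI)
      fix x y assume xy: "x \<in> {x. 2 \<le> h x}" "y \<in> {x. 2 \<le> h x}"
        "rank h x + m * h x = rank h y + m * h y"
      then have "h x = h y" using div[of x] div[of y] by simp
      with xy show "x = y" using inj_onD[OF inj_on_rank[of h "h x"]] by simp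
    qed
    show "x \<in> A \<longleftrightarrow> rank h x + m * h x \<in> autojoin m B" if "x \<in> {x. 2 \<le> h x}" for x
      using that div[of x] by (simp add: A mem_autojoin_iff[OF m])
    show "x \<in> A \<longleftrightarrow> x \<in> {x. h x = 1}" if "x \<notin> {x. 2 \<le> h x}" for x
      using that small[of "h x"] B01 by (auto simp: A)
  qed
  moreover have "autojoin m B \<le>\<^sub>1 A"
  proof -
    \<comment> \<open>The inverse of the matching. The disjunct \<open>n div m < 2\<close> only
      makes the search total: such \<open>n\<close> lie outside \<open>D\<close> and are
      displaced.\<close>
    define g where "g n = (LEAST x. n div m < 2 \<or> h x = n div m \<and> rank h x = n mod m)" for n
    have ex: "\<exists>x. n div m < 2 \<or> h x = n div m \<and> rank h x = n mod m" for n
      using rank_surj[OF fin, of "n div m" "n mod m"] fib[of "n div m"] m by fastforce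
    have g: "h (g n) = n div m \<and> rank h (g n) = n mod m" if "2 \<le> n div m" for n
      using LeastI_ex[OF ex[of n]] that unfolding g_def by simp
    show ?thesis
    proof (rule one_le_displacement[where D = "{n. 2 \<le> n div m}" and E = "{n. n div m = 1}"
          and g = g])
      show "computable_set {n. 2 \<le> n div m}" "computable_set {n. n div m = 1}"
        unfolding computable_set_iff mem_Collect_eq by (intro recursive_intros)+
      show "computable g" unfolding computable_in_iff g_def
        by (intro recursive_on_Least recursive_intros hr rr ex)
      show "inj_on g {n. 2 \<le> n div m}"
      proof (rule inj_onI)
        fix a b assume ab: "a \<in> {n. 2 \<le> n div m}" "b \<in> {n. 2 \<le> n div m}" "g a = g b"
        then have "a div m = b div m" "a mod m = b mod m" using g[of a] g[of b] by simp_all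
        then have "a div m * m + a mod m = b div m * m + b mod m" by (simp only:)
        then show "a = b" unfolding div_mult_mod_eq .
      qed
      show "n \<in> autojoin m B \<longleftrightarrow> g n \<in> A" if "n \<in> {n. 2 \<le> n div m}" for n
      proof -
        have "h (g n) = n div m" using that g[of n] by blast
        then show ?thesis unfolding A mem_autojoin_iff[OF m] vimage_eq by (simp only:)
      qed
      show "n \<in> autojoin m B \<longleftrightarrow> n \<in> {n. n div m = 1}" if "n \<notin> {n. 2 \<le> n div m}" for n
      proof -
        have "n div m = 0 \<or> n div m = 1" using that small[of "n div m"] by (simp add: not_le)
        then show ?thesis unfolding mem_autojoin_iff[OF m] mem_Collect_eq using B01
          by (elim disjE) (simp_all only:, simp_all)
      qed
    qed fact
  qed
  ultimately show ?thesis by (simp add: one_equiv_def)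
qed

text \<open>If \<open>U\<close> is decidable then so is its cylinder, and with \<open>D\<close>
  empty all of the cylinder is displaced into the reservoirs of \<open>U\<close>. Noncomputability
  thus follows from not being a cylinder.\<close>

lemma is_cylinder_if_computable_set:
  assumes "computable_set U" "computable_reservoirs U" shows "is_cylinder U"
proof -
  have "U \<le>\<^sub>1 Cyl U" unfolding one_le_def computable_in_iff
    by (intro exI[of _ "\<lambda>x. prod_encode (x, 0)"] conjI recursive_intros)
       (auto simp: mem_Cyl_iff inj_def)
  moreover have "Cyl U \<le>\<^sub>1 U"
  proof (rule one_le_displacement[where D = "{}" and E = "Cyl U" and g = "\<lambda>x. x"])
    show "computable_set {}" unfolding computable_set_iff decidable_on_def
      by (simp add: recursive_on_const)
    show "computable_set (Cyl U)" unfolding computable_set_iff mem_Cyl_iff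
      by (intro decidable_on_comp[OF assms(1)[unfolded computable_set_iff]] recursive_intros)
    show "computable (\<lambda>x. x)" unfolding computable_in_iff by (rule recursive_on_id)
  qed (use assms in auto)
  ultimately show ?thesis by (simp add: is_cylinder_def one_equiv_def)
qed

section \<open>Index functions and the jump\<close>

primrec subst_oracle :: "prog \<Rightarrow> prog \<Rightarrow> prog" where
  "subst_oracle q PZero = PZero"
| "subst_oracle q PSucc = PSucc"
| "subst_oracle q PFst = PFst"
| "subst_oracle q PSnd = PSnd"
| "subst_oracle q POracle = q"
| "subst_oracle q (PPair p p') = PPair (subst_oracle q p) (subst_oracle q p')"
| "subst_oracle q (PComp p p') = PComp (subst_oracle q p) (subst_oracle q p')"
| "subst_oracle q (PRec p p') = PRec (subst_oracle q p) (subst_oracle q p')"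
| "subst_oracle q (PMu p) = PMu (subst_oracle q p)"

lemma runf_subst_oracle:
  assumes "\<And>x. runf f q x = Some (g x)"
  shows "runf f (subst_oracle q p) = runf g p"
proof -
  have "runf f q = (\<lambda>x. Some (g x))" using assms by blast
  then show ?thesis by (induction p) (simp_all cong: if_cong)
qed

lemma recursive_on_singletonE:
  assumes "recursive_on {g} F" obtains p where "\<And>x. runf g p x = Some (F g x)"
  using assms unfolding recursive_on_def by blast

lemma recursive_on_transfer:
  assumes F: "recursive_on {g} (\<lambda>_. F)" and g: "recursive_on S (\<lambda>_. g)"
  shows "recursive_on S (\<lambda>_. F)"
proof -
  obtain p where p: "\<And>x. runf g p x = Some (F x)"
    using F by (rule recursive_on_singletonE) blast
  obtain q where q: "\<And>f x. f \<in> S \<Longrightarrow> runf f q x = Some (g x)"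
    using g by (rule recursive_onE) blast
  show ?thesis
    by (rule recursive_onI[of _ "subst_oracle q p"]) (simp add: runf_subst_oracle[OF q] p)
qed

lemma recursive_on_if_computable: "computable F \<Longrightarrow> recursive_on S (\<lambda>_. F)"
  unfolding computable_in_iff
  by (erule recursive_on_transfer) (simp add: recursive_on_const)

lemmas recursive_on_computable = recursive_on_comp[OF recursive_on_if_computable]

text \<open>For a fixed \<open>p\<close> the substitution only rebuilds \<open>p\<close> around
  \<open>q\<close>, so its effect on indices is a fixed composition of coding operations.\<close>

lemma prog_index_subst_oracle:
  "\<exists>s. computable s \<and> (\<forall>q. prog_index (subst_oracle q p) = s (prog_index q))"
proof (induction p)
  case POracle
  show ?case by (rule exI[of _ "\<lambda>x. x"]) (simp add: computable_in_iff recursive_on_id)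
next
  case (PPair p1 p2)
  then obtain s1 s2 where s: "computable s1" "computable s2"
    "\<And>q. prog_index (subst_oracle q p1) = s1 (prog_index q)"
    "\<And>q. prog_index (subst_oracle q p2) = s2 (prog_index q)" by blast
  show ?case
    by (rule exI[of _ "\<lambda>x. 5 + 4 * prod_encode (s1 x, s2 x)"], rule conjI, unfold computable_in_iff)
       (intro recursive_intros recursive_on_computable[OF s(1)]
          recursive_on_computable[OF s(2)], simp add: s)
next
  case (PComp p1 p2)
  then obtain s1 s2 where s: "computable s1" "computable s2"
    "\<And>q. prog_index (subst_oracle q p1) = s1 (prog_index q)"
    "\<And>q. prog_index (subst_oracle q p2) = s2 (prog_index q)" by blast
  show ?case
    by (rule exI[of _ "\<lambda>x. 6 + 4 * prod_encode (s1 x, s2 x)"], rule conjI, unfold computable_in_iff)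
       (intro recursive_intros recursive_on_computable[OF s(1)]
          recursive_on_computable[OF s(2)], simp add: s)
next
  case (PRec p1 p2)
  then obtain s1 s2 where s: "computable s1" "computable s2"
    "\<And>q. prog_index (subst_oracle q p1) = s1 (prog_index q)"
    "\<And>q. prog_index (subst_oracle q p2) = s2 (prog_index q)" by blast
  show ?case
    by (rule exI[of _ "\<lambda>x. 7 + 4 * prod_encode (s1 x, s2 x)"], rule conjI, unfold computable_in_iff)
       (intro recursive_intros recursive_on_computable[OF s(1)]
          recursive_on_computable[OF s(2)], simp add: s)
next
  case (PMu p)
  then obtain s where s: "computable s" "\<And>q. prog_index (subst_oracle q p) = s (prog_index q)"
    by blast
  show ?case
    by (rule exI[of _ "\<lambda>x. 8 + 4 * s x"], rule conjI, unfold computable_in_iff)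
       (intro recursive_intros recursive_on_computable[OF s(1)], simp add: s)
qed (auto simp: computable_in_iff intro: recursive_on_const)

text \<open>A form of the s-m-n theorem: a program for \<open>f\<close> is substituted into the
  uniform program for \<open>F\<close>.\<close>

lemma recursive_on_index_function:
  assumes "recursive_on S F"
  obtains s where "computable s"
    "\<And>i f. f \<in> S \<Longrightarrow> phi {} i = (\<lambda>x. Some (f x)) \<Longrightarrow> phi {} (s i) = (\<lambda>x. Some (F f x))"
proof -
  obtain p where p: "\<And>f x. f \<in> S \<Longrightarrow> runf f p x = Some (F f x)"
    using assms by (rule recursive_onE) blast
  obtain s where s: "computable s" "\<And>q. prog_index (subst_oracle q p) = s (prog_index q)"
    using prog_index_subst_oracle by blast
  have "phi {} (s i) = (\<lambda>x. Some (F f x))"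
    if "f \<in> S" "phi {} i = (\<lambda>x. Some (f x))" for i f
  proof -
    obtain q where q: "prog_index q = i" "phi {} i = run {} q" by (rule phi_program)
    then have "runf (ind {}) q x = Some (f x)" for x using that(2) by (metis run_eq_runf)
    then have "runf (ind {}) (subst_oracle q p) = runf f p" by (rule runf_subst_oracle)
    then show ?thesis
      using phi_prog_index[of "{}" "subst_oracle q p"] p[OF that(1)]
      by (simp add: s q(1) run_eq_runf fun_eq_iff)
  qed
  with s(1) that show thesis by blast
qed

text \<open>The program that on input \<open>n\<close> searches for \<open>m\<close> is total
  exactly when the Pi_2 statement holds. The number \<open>8 + 4 * s i\<close> is the index of this
  search.\<close>

lemma unbounded_search_index_function:
  assumes "decidable_on S (\<lambda>f x. R f (pi1 x) (pi2 x))"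
  obtains t where "computable t"
    "\<And>i f. f \<in> S \<Longrightarrow> phi {} i = (\<lambda>x. Some (f x)) \<Longrightarrow>
      (\<forall>n. phi {} (t i) n \<noteq> None) \<longleftrightarrow> (\<forall>n. \<exists>m. R f n m)"
proof -
  obtain s where s: "computable s"
    "\<And>i f. f \<in> S \<Longrightarrow> phi {} i = (\<lambda>x. Some (f x)) \<Longrightarrow>
      phi {} (s i) = (\<lambda>x. Some (of_bool (\<not> R f (pi1 x) (pi2 x))))"
    using recursive_on_index_function[OF decidable_on_not[OF assms, unfolded decidable_on_def]] by blast
  have "computable (\<lambda>i. 8 + 4 * s i)"
    unfolding computable_in_iff by (intro recursive_intros recursive_on_computable[OF s(1)])
  moreover have "(\<forall>n. phi {} (8 + 4 * s i) n \<noteq> None) \<longleftrightarrow> (\<forall>n. \<exists>m. R f n m)"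
    if "f \<in> S" "phi {} i = (\<lambda>x. Some (f x))" for i f
  proof -
    obtain q where q: "prog_index q = s i" "phi {} (s i) = run {} q" by (rule phi_program)
    have "phi {} (8 + 4 * s i) = run {} (PMu q)"
      using phi_prog_index[of "{}" "PMu q"] q(1) by simp
    then show ?thesis using s(2)[OF that] q(2) by (simp split: if_splits)
  qed
  ultimately show thesis using that by blast
qed

definition const_index :: "nat \<Rightarrow> nat" where "const_index n = prog_index (const_prog n)"

lemma recursive_on_const_index:
  assumes "recursive_on S F" shows "recursive_on S (\<lambda>f x. const_index (F f x))"
proof -
  have "const_index n = rec_nat 0 (\<lambda>k r. 6 + 4 * prod_encode (1, r)) n" for n
    by (induction n) (simp_all add: const_index_def)
  then show ?thesis
    by (simp only:) (intro recursive_intros assms)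
qed

text \<open>The index of a program that ignores its input and runs program \<open>i\<close> on
  \<open>x\<close>. It turns halting on an arbitrary argument into membership in the diagonal set
  \<open>jump A\<close>.\<close>

definition apply_index :: "nat \<Rightarrow> nat \<Rightarrow> nat" where
  "apply_index i x = 6 + 4 * prod_encode (i, const_index x)"

lemma phi_apply_index [simp]: "phi A (apply_index i x) y = phi A i x"
proof -
  obtain p where p: "prog_index p = i" "phi A i = run A p" by (rule phi_program)
  then have "phi A (apply_index i x) = run A (PComp p (const_prog x))"
    using phi_prog_index[of A "PComp p (const_prog x)"] by (simp add: apply_index_def const_index_def)
  with p show ?thesis by (simp add: run_eq_runf)
qed

lemma recursive_on_apply_index:
  assumes "recursive_on S F" "recursive_on S G"
  shows "recursive_on S (\<lambda>f x. apply_index (F f x) (G f x))"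
  unfolding apply_index_def by (intro recursive_intros recursive_on_const_index assms)

section \<open>Decidability relative to the jump\<close>

lemma decidable_on_mem_oracle:
  assumes "recursive_on {ind A} F" shows "decidable_on {ind A} (\<lambda>f x. F f x \<in> A)"
  using recursive_on_oracle[OF assms] unfolding decidable_on_def
  by (rule recursive_on_cong) simp

lemma decidable_on_halts:
  assumes "recursive_on {ind (jump A)} F" "recursive_on {ind (jump A)} G"
  shows "decidable_on {ind (jump A)} (\<lambda>f x. phi A (F f x) (G f x) \<noteq> None)"
proof -
  have "phi A i x \<noteq> None \<longleftrightarrow> apply_index i x \<in> jump A" for i x
    by (simp add: jump_def)
  then show ?thesis
    by (simp only:) (intro decidable_on_mem_oracle recursive_on_apply_index assms)
qed

text \<open>The search for \<open>k\<close> by \<open>PMu\<close> halts exactly when some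
  \<open>k\<close> exists, so one halting question suffices.\<close>

lemma decidable_on_jump_ex:
  assumes "decidable_on {ind A} (\<lambda>_ x. R (pi1 x) (pi2 x))"
  shows "decidable_on {ind (jump A)} (\<lambda>_ x. \<exists>k. R x k)"
proof -
  obtain p where p: "\<And>x. runf (ind A) p x = Some (of_bool (\<not> R (pi1 x) (pi2 x)))"
    using decidable_on_not[OF assms] unfolding decidable_on_def by (rule recursive_on_singletonE) blast
  have "phi A (prog_index (PMu p)) x \<noteq> None \<longleftrightarrow> (\<exists>k. R x k)" for x
    by (simp only: phi_prog_index run_eq_runf) (simp add: p)
  moreover have "decidable_on {ind (jump A)} (\<lambda>_ x. phi A (prog_index (PMu p)) x \<noteq> None)"
    by (intro decidable_on_halts recursive_on_const recursive_on_id)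
  ultimately show ?thesis by simp
qed

lemma decidable_on_jump_all:
  assumes "decidable_on {ind A} (\<lambda>_ x. R (pi1 x) (pi2 x))"
  shows "decidable_on {ind (jump A)} (\<lambda>_ x. \<forall>k. R x k)"
  using decidable_on_not[OF decidable_on_jump_ex[OF decidable_on_not[OF assms]]] by simp

lemma recursive_on_jump:
  assumes "recursive_on {ind A} (\<lambda>_. F)" shows "recursive_on {ind (jump A)} (\<lambda>_. F)"
proof (rule recursive_on_transfer[OF assms])
  have "decidable_on {ind A} (\<lambda>_ x. pi1 x \<in> A)"
    by (intro decidable_on_mem_oracle recursive_intros)
  \<comment> \<open>With a dummy quantifier over \<open>k\<close>, membership in \<open>A\<close>
    becomes a question about the jump.\<close>
  from decidable_on_jump_ex[of A "\<lambda>x k. x \<in> A", OF this]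
  show "recursive_on {ind (jump A)} (\<lambda>_. ind A)" by (simp add: decidable_on_def)
qed

text \<open>Divergence is mapped to the junk value \<open>0\<close>, which makes evaluation total.\<close>

definition ev :: "nat \<Rightarrow> nat \<Rightarrow> nat" where
  "ev i x = (case phi {} i x of None \<Rightarrow> 0 | Some v \<Rightarrow> v)"

lemma ev_eq: "phi {} i = (\<lambda>x. Some (f x)) \<Longrightarrow> ev i x = f x"
  by (simp add: ev_def)

lemma decidable_on_graph:
  assumes "recursive_on {ind (jump {})} F" "recursive_on {ind (jump {})} G"
    "recursive_on {ind (jump {})} H"
  shows "decidable_on {ind (jump {})} (\<lambda>f x. phi {} (F f x) (G f x) = Some (H f x))"
proof -
  have "decidable_on {ind {}} (\<lambda>_ x. pi1 (pi1 x) \<noteq> pi2 (pi1 x))"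
    by (intro recursive_intros)
  then obtain p where p: "\<And>x. runf (ind {}) p x = Some (of_bool (pi1 (pi1 x) \<noteq> pi2 (pi1 x)))"
    unfolding decidable_on_def by (rule recursive_on_singletonE) blast
  \<comment> \<open>On a pair of \<open>a\<close> and \<open>v\<close> the search
    \<open>PMu p\<close> halts exactly when \<open>a = v\<close>. Hence program
    \<open>s i x v\<close> halts exactly when program \<open>i\<close> converges on \<open>x\<close>
    with value \<open>v\<close>.\<close>
  let ?e = "prog_index (PMu p)"
  define s where "s i x v = 6 + 4 * prod_encode (?e,
    5 + 4 * prod_encode (apply_index i x, const_index v))" for i x v
  have "phi {} i x = Some v \<longleftrightarrow> phi {} (s i x v) 0 \<noteq> None" for i x v
  proof -
    obtain q where q: "prog_index q = apply_index i x" "phi {} (apply_index i x) = run {} q"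
      by (rule phi_program)
    have "phi {} (s i x v) = run {} (PComp (PMu p) (PPair q (const_prog v)))"
      using phi_prog_index[of "{}" "PComp (PMu p) (PPair q (const_prog v))"] q(1)
      by (simp add: s_def const_index_def)
    moreover have "runf (ind {}) q 0 = phi {} i x" using q(2) run_eq_runf by (metis phi_apply_index)
    ultimately show ?thesis
      by (cases "phi {} i x") (simp_all add: run_eq_runf p del: empty_iff)
  qed
  then show ?thesis
    by (simp only:) (unfold s_def, intro decidable_on_halts recursive_intros
        recursive_on_apply_index recursive_on_const_index assms)
qed

lemma recursive_on_ev:
  assumes "recursive_on {ind (jump {})} F" "recursive_on {ind (jump {})} G"
  shows "recursive_on {ind (jump {})} (\<lambda>f x. ev (F f x) (G f x))"
proof -
  \<comment> \<open>On divergence every \<open>v\<close> qualifies, so the least one is the default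
    0.\<close>
  have *: "ev i x = (LEAST v. phi {} i x = Some v \<or> \<not> phi {} i x \<noteq> None)" for i x
    unfolding ev_def by (cases "phi {} i x") (auto intro!: Least_equality[symmetric])
  have ex: "\<exists>v. phi {} i x = Some v \<or> \<not> phi {} i x \<noteq> None" for i x by auto
  show ?thesis unfolding *
    by (intro recursive_on_Least decidable_on_disj decidable_on_not decidable_on_graph
      decidable_on_halts recursive_intros recursive_on_comp[OF assms(1)]
      recursive_on_comp[OF assms(2)] ex)
qed

text \<open>The search is known to succeed only at the states \<open>st n\<close> actually reached,
  whereas \<open>recursive_on_Least\<close> asks for success at every argument. The program is
  therefore assembled by hand and followed along \<open>st\<close>.\<close>

lemma recursive_on_search_rec:
  assumes P: "decidable_on {f} (\<lambda>_ x. P (pi1 x) (pi2 x))"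
    and H: "recursive_on {f} (\<lambda>_ x. H (pi1 x) (pi2 x))"
    and ex: "\<And>n. \<exists>w. P (prod_encode (n, st n)) w"
    and step: "\<And>n. st (Suc n) =
      H (prod_encode (n, st n)) (LEAST w. P (prod_encode (n, st n)) w)"
  shows "recursive_on {f} (\<lambda>_. st)"
proof -
  obtain p where p: "\<And>x. runf f p x = Some (of_bool (\<not> P (pi1 x) (pi2 x)))"
    using decidable_on_not[OF P] unfolding decidable_on_def by (rule recursive_on_singletonE) blast
  obtain h where h: "\<And>x. runf f h x = Some (H (pi1 x) (pi2 x))"
    using H by (rule recursive_on_singletonE) blast
  let ?step = "PComp h (PPair PSnd (PComp (PMu p) PSnd))"
  let ?r = "PRec (const_prog (st 0)) ?step"
  have "runf f ?step (prod_encode (a, prod_encode (n, st n))) = Some (st (Suc n))" for a n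
    using ex[of n] by (simp add: p h step)
  then have "runf f ?r (prod_encode (a, n)) = Some (st n)" for a n
    by (induction n) (simp_all del: runf.simps(6,7,9))
  then show ?thesis
    by (intro recursive_onI[of _ "PComp ?r (PPair PZero id_prog)"]) (simp del: runf.simps(8))
qed

section \<open>One thinning step\<close>

text \<open>The number \<open>m\<close> codes a coordinate and a bound below which its fibre is
  counted. That such an \<open>m\<close> exists for every \<open>n\<close> is a Pi_2 statement,
  saying that \<open>k\<close> does not exceed the limit superior of the fibre sizes.\<close>

definition large_fibre :: "(nat \<Rightarrow> nat) \<Rightarrow> nat \<Rightarrow> nat \<Rightarrow> nat \<Rightarrow> bool" where
  "large_fibre q k n m \<longleftrightarrow> n < pi1 m \<and> k \<le> count_below q (pi1 m) (pi2 m)"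

text \<open>The coordinate of the first witness met in the search, which need not be the least
  suitable coordinate.\<close>

definition next_large :: "(nat \<Rightarrow> nat) \<Rightarrow> nat \<Rightarrow> nat \<Rightarrow> nat" where
  "next_large q k n = pi1 (LEAST m. large_fibre q k n m)"

definition large_seq :: "(nat \<Rightarrow> nat) \<Rightarrow> nat \<Rightarrow> nat \<Rightarrow> nat \<Rightarrow> nat" where
  "large_seq q k N n = rec_nat (next_large q k N) (\<lambda>_ y. next_large q k y) n"

text \<open>The element \<open>y\<^sub>n\<close> of the chosen sparse set \<open>Y\<close> goes, according to \<open>n mod 4\<close>, to the
  merged coordinate \<open>n div 4 + 2\<close> (twice), to the colour \<open>0\<close>, or to the colour \<open>1\<close>. Outside \<open>Y\<close>
  the colours are arranged so that \<open>2\<close> and \<open>z\<close> receive different ones.\<close>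

definition thinning :: "(nat \<Rightarrow> nat) \<Rightarrow> nat \<Rightarrow> nat \<Rightarrow> nat \<Rightarrow> nat \<Rightarrow> nat" where
  "thinning q k N z j =
    (if large_seq q k N (LEAST n. j \<le> large_seq q k N n) = j
     then (if (LEAST n. j \<le> large_seq q k N n) mod 4 < 2
           then (LEAST n. j \<le> large_seq q k N n) div 4 + 2
           else (LEAST n. j \<le> large_seq q k N n) mod 4 - 2)
     else of_bool (j = 1 \<or> j = (if z = 0 then 2 else z)))"

lemma next_large:
  assumes "\<exists>m. large_fibre q k n m"
  shows "n < next_large q k n" "\<exists>b. k \<le> count_below q (next_large q k n) b"
  using LeastI_ex[OF assms] by (auto simp: next_large_def large_fibre_def)

lemma large_seq_gt:
  assumes "\<And>n. \<exists>m. large_fibre q k n m" shows "N + n < large_seq q k N n"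
proof (induction n)
  case 0
  then show ?case using next_large(1)[OF assms] by (simp add: large_seq_def)
next
  case (Suc n)
  then show ?case using next_large(1)[OF assms, of "large_seq q k N n"]
    by (simp add: large_seq_def)
qed

text \<open>The first term of the increasing sequence that reaches \<open>j\<close> decides whether
  \<open>j\<close> belongs to it. That search stops because the term with index \<open>j\<close>
  already exceeds \<open>j\<close>.\<close>

lemma recursive_on_thinning:
  assumes q: "recursive_on S q" and k: "recursive_on S (\<lambda>f _. k f)"
    and N: "recursive_on S (\<lambda>f _. N f)" and z: "recursive_on S (\<lambda>f _. z f)"
    and ex: "\<And>f n. f \<in> S \<Longrightarrow> \<exists>m. large_fibre (q f) (k f) n m"
  shows "recursive_on S (\<lambda>f j. thinning (q f) (k f) (N f) (z f) j)"
proof -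
  have nl: "recursive_on S (\<lambda>f x. next_large (q f) (k f) (G f x))" if "recursive_on S G" for G
    unfolding next_large_def
    by (intro recursive_on_pi1 recursive_on_Least ex)
       (unfold large_fibre_def, intro recursive_intros recursive_on_count_below q k
          recursive_on_comp[OF that])
  have ls: "recursive_on S (\<lambda>f x. large_seq (q f) (k f) (N f) (G f x))" if "recursive_on S G" for G
    unfolding large_seq_def by (intro recursive_on_rec nl N that recursive_intros)
  have lt: "\<exists>n. j \<le> large_seq (q f) (k f) (N f) n" if "f \<in> S" for f j
    using large_seq_gt[OF ex[OF that], of "N f" j] by (intro exI[of _ j]) simp
  show ?thesis unfolding thinning_def
    by (intro recursive_on_Least recursive_intros ls N z lt)
qed

text \<open>The first two assumptions make \<open>k\<close> the limit superior of the fibre sizes,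
  with \<open>N\<close> a threshold beyond which it is not exceeded. The others keep 0, 1, 2 and
  \<open>z\<close> outside the chosen set, whose members all exceed \<open>N\<close>, and allow 2
  and \<open>z\<close> different colours.\<close>

locale thinning_data =
  fixes q :: "nat \<Rightarrow> nat" and k N z :: nat
  assumes large: "\<And>n. \<exists>m. large_fibre q k n m"
    and bound: "\<And>j b. N < j \<Longrightarrow> count_below q j b \<le> k"
    and N2: "2 \<le> N" and zN: "z \<le> N" and z2: "z \<noteq> 2"
begin

definition y :: "nat \<Rightarrow> nat" where "y = large_seq q k N"
definition d :: "nat \<Rightarrow> nat" where "d = thinning q k N z"

lemma y_gt: "N + n < y n" unfolding y_def by (rule large_seq_gt[OF large])

lemma y_strict_mono: "strict_mono y"
  unfolding strict_mono_Suc_iff y_def using next_large(1)[OF large] by (simp add: large_seq_def)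

lemma y_eq_iff [simp]: "y n = y m \<longleftrightarrow> n = m"
  by (rule strict_mono_eq[OF y_strict_mono])

text \<open>Since \<open>y n\<close> exceeds \<open>N\<close>, its fibre has at most
  \<open>k\<close> elements; the witness that selected it supplies at least
  \<open>k\<close>.\<close>

lemma fibre_y: "finite (q -` {y n})" "card (q -` {y n}) = k"
proof -
  have le: "count_below q (y n) b \<le> k" for b using y_gt[of n] by (intro bound) simp
  show fin: "finite (q -` {y n})" by (rule finite_fibre_if_count_below_le[OF le])
  have "\<exists>b. k \<le> count_below q (y n) b"
    using next_large(2)[OF large] by (cases n) (simp_all add: y_def large_seq_def)
  then obtain b where "k \<le> count_below q (y n) b" by blast
  also have "\<dots> \<le> card (q -` {y n})" by (rule count_below_le_card[OF fin])
  finally show "card (q -` {y n}) = k"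
    using finite_fibre_if_count_below_le(2)[OF le] by simp
qed

lemma d_y: "d (y n) = (if n mod 4 < 2 then n div 4 + 2 else n mod 4 - 2)"
proof -
  have "(LEAST m. y n \<le> y m) = n"
    by (rule Least_equality) (simp_all add: strict_mono_less_eq[OF y_strict_mono])
  then show ?thesis unfolding d_def thinning_def y_def[symmetric] by simp
qed

lemma d_not_y:
  assumes "j \<notin> range y" shows "d j = of_bool (j = 1 \<or> j = (if z = 0 then 2 else z))"
proof -
  have "y (LEAST n. j \<le> y n) \<noteq> j" using assms by (metis rangeI)
  then show ?thesis unfolding d_def thinning_def y_def[symmetric] by (simp only: if_False)
qed

lemma d_le_N:
  assumes "j \<le> N" shows "d j = of_bool (j = 1 \<or> j = (if z = 0 then 2 else z))"
proof (rule d_not_y)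
  have "j < y n" for n using y_gt[of n] assms by linarith
  then show "j \<notin> range y" by blast
qed

lemma d_0: "d 0 = 0"
  using d_le_N[of 0] by simp

lemma d_1: "d 1 = 1"
  using d_le_N[of 1] N2 by simp

text \<open>If \<open>z = 0\<close>, the point 2 receives colour 1; otherwise \<open>z\<close>
  receives it, and 2 receives colour 0. The case \<open>z = 1\<close> agrees with the fixed colour
  of 1.\<close>

lemma d_2_z: "d 2 \<le> 1" "d z \<le> 1" "d 2 \<noteq> d z"
  using d_le_N[OF N2] d_le_N[OF zN] z2 by (cases "z = 0"; simp)+

text \<open>A merged coordinate is \<open>n div 4 + 2\<close>, while \<open>y n\<close> exceeds
  \<open>N + n\<close> and \<open>N\<close> is at least 2. All other values are 0 or 1.\<close>

lemma d_less: "2 \<le> j \<Longrightarrow> d j < j"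
proof (cases "j \<in> range y")
  case True
  then obtain n where n: "j = y n" by blast
  show ?thesis using y_gt[of n] N2 unfolding n d_y by auto
qed (simp add: d_not_y)

lemma infinite_d_fibres: "infinite (d -` {0})" "infinite (d -` {1})"
proof -
  have "infinite (d -` {i})" if "i < 2" for i
  proof
    assume "finite (d -` {i})"
    moreover have "(\<lambda>n. y (4 * n + (2 + i))) ` UNIV \<subseteq> d -` {i}"
      using that by (auto simp: d_y simp del: add_2_eq_Suc add_2_eq_Suc')
    ultimately have "finite (range (\<lambda>n. y (4 * n + (2 + i))))" by (rule rev_finite_subset)
    then have "finite (UNIV :: nat set)"
      by (rule finite_imageD) (simp add: inj_on_def)
    then show False by simp
  qed
  then show "infinite (d -` {0})" "infinite (d -` {1})" by simp_all
qed

lemma d_fibre: "2 \<le> j \<Longrightarrow> d -` {j} = {y (4 * (j - 2)), y (4 * (j - 2) + 1)}"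
proof (intro equalityI subsetI)
  fix x assume j: "2 \<le> j" and x: "x \<in> d -` {j}"
  have "d x \<le> 1" if "x \<notin> range y" unfolding d_not_y[OF that] by simp
  moreover have "d x = j" using x by simp
  ultimately have "x \<in> range y" using j by linarith
  then obtain n where n: "x = y n" by blast
  have dn: "(if n mod 4 < 2 then n div 4 + 2 else n mod 4 - 2) = j"
    using \<open>d x = j\<close> unfolding n d_y .
  have "n mod 4 - 2 < 2" by presburger
  with dn j have "n mod 4 < 2" "n div 4 + 2 = j" by (simp_all split: if_splits)
  then have "n = 4 * (j - 2) \<or> n = 4 * (j - 2) + 1" by presburger
  then show "x \<in> {y (4 * (j - 2)), y (4 * (j - 2) + 1)}" unfolding n by auto
qed (auto simp: d_y)

lemma card_d_fibre: "2 \<le> j \<Longrightarrow> card (d -` {j}) = 2"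
  by (simp add: d_fibre)

text \<open>Over \<open>j \<ge> 2\<close> only two chosen points are merged, so the sizes of the
  fibres of \<open>h\<close> over the chosen points alone matter. This serves both for
  \<open>c\<close> and for \<open>c\<close> after \<phi>.\<close>

lemma card_comp_fibre:
  assumes "\<And>n. finite (h -` {y n})" "\<And>n. card (h -` {y n}) = s" "2 \<le> j"
  shows "card ((\<lambda>x. d (h x)) -` {j}) = 2 * s"
proof -
  let ?a = "4 * (j - 2)"
  have "(\<lambda>x. d (h x)) -` {j} = h -` (d -` {j})" by auto
  also have "\<dots> = h -` {y ?a} \<union> h -` {y (?a + 1)}" unfolding d_fibre[OF assms(3)] by auto
  also have "card \<dots> = card (h -` {y ?a}) + card (h -` {y (?a + 1)})"
  proof (intro card_Un_disjoint assms(1))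
    show "h -` {y ?a} \<inter> h -` {y (?a + 1)} = {}"
      using y_eq_iff[of ?a "?a + 1"] by auto
  qed
  finally show ?thesis by (simp add: assms(2))
qed

end

lemma large_fibre_le:
  assumes "\<And>n. \<exists>m. large_fibre q k n m"
    and "\<And>j. 2 \<le> j \<Longrightarrow> finite (q -` {j}) \<and> card (q -` {j}) \<le> M"
  shows "k \<le> M"
proof -
  obtain m where "1 < pi1 m" "k \<le> count_below q (pi1 m) (pi2 m)"
    using assms(1)[of 1] by (auto simp: large_fibre_def)
  moreover have "2 \<le> pi1 m" using calculation(1) by simp
  ultimately show ?thesis
    using count_below_le_card[of q "pi1 m" "pi2 m"] assms(2)[of "pi1 m"] by linarith
qed

text \<open>The bound \<open>M\<close> on the fibre sizes gives a greatest \<open>k\<close> attained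
  or exceeded arbitrarily far out. Its maximality makes \<open>Suc k\<close> fail beyond some
  \<open>N\<close>.\<close>

lemma thinning_parameters_exist:
  assumes fib: "\<And>j. 2 \<le> j \<Longrightarrow> finite (q -` {j}) \<and> card (q -` {j}) \<le> M"
  shows "\<exists>k N. (\<forall>n. \<exists>m. large_fibre q k n m) \<and> (\<forall>j b. N < j \<longrightarrow> count_below q j b \<le> k)"
proof -
  let ?T = "\<lambda>k. \<forall>n. \<exists>m. large_fibre q k n m"
  have "large_fibre q 0 n (prod_encode (Suc n, 0))" for n by (simp add: large_fibre_def)
  then have T0: "?T 0" by blast
  have le: "k \<le> M" if "?T k" for k using that by (intro large_fibre_le[OF _ fib]) blast+
  define k where "k = (GREATEST k. ?T k)"
  have "?T k" unfolding k_def by (rule GreatestI_nat[of ?T, OF T0 le])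
  moreover have "\<not> ?T (Suc k)"
    using Greatest_le_nat[of ?T "Suc k" M] le unfolding k_def by fastforce
  then obtain N where "\<And>m. \<not> large_fibre q (Suc k) N m" by blast
  then have "count_below q j b \<le> k" if "N < j" for j b
    using that by (metis fst_conv snd_conv large_fibre_def not_less_eq_eq prod_encode_inverse)
  ultimately show ?thesis by blast
qed

text \<open>The column over a point with \<open>c\<close>-coordinate 2 is followed until \<phi>
  sends one of its members to another coordinate. Colouring that coordinate and 2 differently
  refutes \<phi> as a reduction of the cylinder.\<close>

definition escaping_value :: "(nat \<Rightarrow> nat) \<Rightarrow> (nat \<Rightarrow> nat) \<Rightarrow> nat" where
  "escaping_value c q = q (prod_encode (LEAST x. c x = 2,
     LEAST t. q (prod_encode (LEAST x. c x = 2, t)) \<noteq> 2))"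

text \<open>With \<open>M = 2 ^ e\<close>, the bound \<open>2 * M\<close> on the fibres of the map
  through \<phi> becomes the bound on the coefficient at level \<open>e + 1\<close>. The last clause
  is the diagonalisation against \<phi>.\<close>

definition thins :: "(nat \<Rightarrow> nat) \<Rightarrow> (nat \<Rightarrow> nat) \<Rightarrow> nat \<Rightarrow> (nat \<Rightarrow> nat) \<Rightarrow> bool" where
  "thins c \<phi> M d \<longleftrightarrow> d 0 = 0 \<and> d 1 = 1 \<and> (\<forall>j\<ge>2. d j < j) \<and>
     infinite (d -` {0}) \<and> infinite (d -` {1}) \<and> (\<forall>j\<ge>2. card (d -` {j}) = 2) \<and>
     (\<forall>j\<ge>2. card ((\<lambda>x. d (c x)) -` {j}) = 2 * M) \<and>
     (\<exists>k\<le>2 * M. \<forall>j\<ge>2. card ((\<lambda>x. d (c (\<phi> x))) -` {j}) = k) \<and>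
     (\<exists>x t. d (c x) \<le> 1 \<and> d (c (\<phi> (prod_encode (x, t)))) \<le> 1 \<and>
        d (c x) \<noteq> d (c (\<phi> (prod_encode (x, t)))))"

section \<open>Correctness of one thinning step\<close>

context
  fixes c \<phi> q :: "nat \<Rightarrow> nat" and M :: nat
  assumes q: "q = (\<lambda>x. c (\<phi> x))" and inj: "inj \<phi>" and M: "1 \<le> M"
    and fib: "\<And>j. 2 \<le> j \<Longrightarrow> card (c -` {j}) = M"
begin

lemma finite_fibre: "2 \<le> j \<Longrightarrow> finite (c -` {j})"
  using fib[of j] M by (metis card.infinite not_one_le_zero)

lemma fibre_q: assumes "2 \<le> j" shows "finite (q -` {j}) \<and> card (q -` {j}) \<le> M"
proof -
  have "q -` {j} = \<phi> -` (c -` {j})" by (auto simp: q)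
  then show ?thesis
    using finite_vimageI[OF finite_fibre[OF assms] inj]
      card_vimage_inj_on_le[OF inj finite_fibre[OF assms]] fib[OF assms] by simp
qed

lemma ex_coordinate_2: "\<exists>x. c x = 2"
proof -
  have "c -` {2} \<noteq> {}" using fib[of 2] M by (metis card.empty not_one_le_zero order_refl)
  then show ?thesis by auto
qed

text \<open>The column over \<open>x\<close> is infinite, whereas the fibre of \<open>q\<close> over
  2 is finite because \<phi> is injective.\<close>

lemma ex_escaping: "\<exists>t. q (prod_encode (x, t)) \<noteq> 2"
proof (rule ccontr)
  assume "\<nexists>t. q (prod_encode (x, t)) \<noteq> 2"
  then have "range (\<lambda>t. prod_encode (x, t)) \<subseteq> q -` {2}" by auto
  then have "finite (range (\<lambda>t. prod_encode (x, t)))"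
    using fibre_q[of 2] finite_subset by blast
  then have "finite (UNIV :: nat set)" by (rule finite_imageD) (simp add: inj_on_def)
  then show False by simp
qed

lemma thins_thinning:
  assumes large: "\<And>n. \<exists>m. large_fibre q k n m"
    and bound: "\<And>j b. N < j \<Longrightarrow> count_below q j b \<le> k"
  shows "thins c \<phi> M (thinning q k (N + 2 + escaping_value c q) (escaping_value c q))"
proof -
  define x0 where "x0 = (LEAST x. c x = 2)"
  define t0 where "t0 = (LEAST t. q (prod_encode (x0, t)) \<noteq> 2)"
  define z where "z = escaping_value c q"
  have x0: "c x0 = 2" unfolding x0_def by (rule LeastI_ex[OF ex_coordinate_2])
  have z: "z = q (prod_encode (x0, t0))" by (simp add: z_def escaping_value_def x0_def t0_def)
  have z2: "z \<noteq> 2" unfolding z t0_def by (rule LeastI_ex[OF ex_escaping])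
  \<comment> \<open>Raising the threshold preserves the upper bound on fibres and puts 2 and
    \<open>z\<close> below every chosen point.\<close>
  interpret thinning_data q k "N + 2 + z" z
    by standard (use large bound z2 in auto)
  have y2: "2 \<le> y n" for n using y_gt[of n] by simp
  have card_c: "card ((\<lambda>x. d (c x)) -` {j}) = 2 * M" if "2 \<le> j" for j
    using card_comp_fibre[OF finite_fibre[OF y2] fib[OF y2] that] .
  have card_q: "card ((\<lambda>x. d (c (\<phi> x))) -` {j}) = 2 * k" if "2 \<le> j" for j
    using card_comp_fibre[OF fibre_y that] unfolding q .
  have "k \<le> M" by (rule large_fibre_le[OF large fibre_q])
  then have "\<exists>k\<le>2 * M. \<forall>j\<ge>2. card ((\<lambda>x. d (c (\<phi> x))) -` {j}) = k"
    using card_q by (intro exI[of _ "2 * k"]) simp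
  moreover have "d (c x0) \<le> 1 \<and> d (c (\<phi> (prod_encode (x0, t0)))) \<le> 1 \<and>
      d (c x0) \<noteq> d (c (\<phi> (prod_encode (x0, t0))))"
    using d_2_z unfolding x0 z[unfolded q, symmetric] by blast
  ultimately have "thins c \<phi> M d"
    unfolding thins_def using d_0 d_1 d_less infinite_d_fibres card_d_fibre card_c by blast
  then show ?thesis unfolding d_def unfolding z_def .
qed

end

text \<open>The oracle of a stage is \<open>x \<mapsto> \<langle>\<langle>c x, \<phi> x\<rangle>, \<langle>k, N\<rangle>\<rangle>\<close>.\<close>

definition stage_index :: "nat \<Rightarrow> nat \<Rightarrow> nat \<Rightarrow> nat" where
  "stage_index i g w = 5 + 4 * prod_encode (5 + 4 * prod_encode (i, g), const_index w)"

lemma phi_stage_index: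
  assumes "phi {} i = (\<lambda>x. Some (c x))" "phi {} g = (\<lambda>x. Some (\<phi> x))"
  shows "phi {} (stage_index i g w) = (\<lambda>x. Some (prod_encode (prod_encode (c x, \<phi> x), w)))"
proof -
  obtain p where p: "prog_index p = i" "phi {} i = run {} p" by (rule phi_program)
  obtain p' where p': "prog_index p' = g" "phi {} g = run {} p'" by (rule phi_program)
  have "phi {} (stage_index i g w) = run {} (PPair (PPair p p') (const_prog w))"
    using phi_prog_index[of "{}" "PPair (PPair p p') (const_prog w)"]
    by (simp add: stage_index_def p(1) p'(1) const_index_def)
  then show ?thesis using assms by (simp add: p(2) p'(2)) (simp add: run_eq_runf)
qed

lemma recursive_on_stage_index:
  assumes "recursive_on S F" "recursive_on S G" "recursive_on S H"
  shows "recursive_on S (\<lambda>f x. stage_index (F f x) (G f x) (H f x))"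
  unfolding stage_index_def by (intro recursive_intros recursive_on_const_index assms)

lemma phi_comp_index:
  assumes "phi {} i = (\<lambda>x. Some (f x))" "phi {} j = (\<lambda>x. Some (g x))"
  shows "phi {} (6 + 4 * prod_encode (i, j)) = (\<lambda>x. Some (f (g x)))"
proof -
  obtain p where p: "prog_index p = i" "phi {} i = run {} p" by (rule phi_program)
  obtain p' where p': "prog_index p' = j" "phi {} j = run {} p'" by (rule phi_program)
  have "phi {} (6 + 4 * prod_encode (i, j)) = run {} (PComp p p')"
    using phi_prog_index[of "{}" "PComp p p'"] by (simp add: p(1) p'(1))
  then show ?thesis using assms by (simp add: p(2) p'(2))
qed

lemma all_nat_pair_iff: "(\<forall>m. Q (pi1 m) (pi2 m)) \<longleftrightarrow> (\<forall>j b. Q j b)"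
proof (intro iffI allI)
  fix j b assume "\<forall>m. Q (pi1 m) (pi2 m)"
  then show "Q j b" by (auto dest: spec[of _ "prod_encode (j, b)"])
qed blast

text \<open>\<open>Good\<close> tests a coded pair of \<open>k\<close> and \<open>N\<close>. Its
  first half is totality of a search; its second is a universal statement decidable from the first
  jump once \<open>ev\<close> makes evaluation total. Both are thus decidable from the second jump
  for arbitrary indices, and \<open>\<delta>\<close> computes an index of the thinning map.\<close>

lemma thinning_stage:
  obtains Good :: "nat \<Rightarrow> nat \<Rightarrow> nat \<Rightarrow> bool" and \<delta> :: "nat \<Rightarrow> nat \<Rightarrow> nat \<Rightarrow> nat" where
    "decidable_on {ind (jump (jump {}))} (\<lambda>_ x. Good (pi1 (pi1 x)) (pi2 (pi1 x)) (pi2 x))"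
    "\<And>S. recursive_on S (\<lambda>_ x. \<delta> (pi1 (pi1 x)) (pi2 (pi1 x)) (pi2 x))"
    "\<forall>i g c \<phi> M. phi {} i = (\<lambda>x. Some (c x)) \<longrightarrow> phi {} g = (\<lambda>x. Some (\<phi> x)) \<longrightarrow> inj \<phi> \<longrightarrow>
      1 \<le> M \<longrightarrow> (\<forall>j\<ge>2. card (c -` {j}) = M) \<longrightarrow>
      (\<exists>w. Good i g w) \<and>
      (\<forall>w. Good i g w \<longrightarrow> (\<exists>d. phi {} (\<delta> i g w) = (\<lambda>x. Some (d x)) \<and> thins c \<phi> M d))"
proof -
  define cf where "cf f x = pi1 (pi1 (f x))" for f :: "nat \<Rightarrow> nat" and x
  define qf where "qf f x = cf f (pi2 (pi1 (f x)))" for f x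
  define kf where "kf f = pi1 (pi2 (f 0))" for f :: "nat \<Rightarrow> nat"
  define Nf where "Nf f = pi2 (pi2 (f 0))" for f :: "nat \<Rightarrow> nat"
  define zf where "zf f = escaping_value (cf f) (qf f)" for f
  \<comment> \<open>Membership in \<open>S\<close> is exactly what makes the searches in
    \<open>escaping_value\<close> and \<open>next_large\<close> stop.\<close>
  define S where "S = {f. (\<exists>x. cf f x = 2) \<and> (\<forall>x. \<exists>t. qf f (prod_encode (x, t)) \<noteq> 2) \<and>
    (\<forall>n. \<exists>m. large_fibre (qf f) (kf f) n m)}"
  have cf: "recursive_on T cf" for T unfolding cf_def by (intro recursive_intros)
  have qf: "recursive_on T qf" for T
    unfolding qf_def by (intro recursive_intros recursive_on_comp[OF cf])
  have kf: "recursive_on T (\<lambda>f _. kf f)" for T unfolding kf_def by (intro recursive_intros)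
  have Nf: "recursive_on T (\<lambda>f _. Nf f)" for T unfolding Nf_def by (intro recursive_intros)
  have x0: "recursive_on S (\<lambda>f _. LEAST x. cf f x = 2)"
    by (intro recursive_on_Least recursive_intros recursive_on_comp[OF cf]) (simp add: S_def)
  have zf: "recursive_on S (\<lambda>f _. zf f)"
    unfolding zf_def escaping_value_def
    by (intro recursive_on_comp[OF qf] recursive_on_pair x0 recursive_on_Least recursive_intros)
       (simp add: S_def)
  have th: "recursive_on S (\<lambda>f. thinning (qf f) (kf f) (Nf f + 2 + zf f) (zf f))"
    by (intro recursive_on_thinning qf kf recursive_intros Nf zf) (simp add: S_def)
  obtain s where s: "computable s" "\<And>i f. f \<in> S \<Longrightarrow> phi {} i = (\<lambda>x. Some (f x)) \<Longrightarrow>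
      phi {} (s i) = (\<lambda>x. Some (thinning (qf f) (kf f) (Nf f + 2 + zf f) (zf f) x))"
    using recursive_on_index_function[OF th] by blast
  \<comment> \<open>Counting below a given bound always terminates, so \<open>k\<close> can be
    tested before the oracle is known to lie in \<open>S\<close>.\<close>
  have lf: "decidable_on UNIV (\<lambda>f x. large_fibre (qf f) (kf f) (pi1 x) (pi2 x))"
    unfolding large_fibre_def by (intro recursive_intros recursive_on_count_below qf kf)
  obtain t where t: "computable t" "\<And>i f. f \<in> UNIV \<Longrightarrow> phi {} i = (\<lambda>x. Some (f x)) \<Longrightarrow>
      (\<forall>n. phi {} (t i) n \<noteq> None) \<longleftrightarrow> (\<forall>n. \<exists>m. large_fibre (qf f) (kf f) n m)"
    by (rule unbounded_search_index_function[OF lf]) (rule that)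
  define Good where "Good i g w \<longleftrightarrow> (\<forall>n. phi {} (t (stage_index i g w)) n \<noteq> None) \<and>
    (\<forall>m. pi2 w < pi1 m \<longrightarrow> count_below (\<lambda>x. ev i (ev g x)) (pi1 m) (pi2 m) \<le> pi1 w)" for i g w
  define \<delta> where "\<delta> i g w = s (stage_index i g w)" for i g w
  show thesis
  proof (rule that[of Good \<delta>])
    have "recursive_on {ind (jump {})} (\<lambda>_ x. count_below (\<lambda>u. ev (pi1 (pi1 (pi1 x)))
        (ev (pi2 (pi1 (pi1 x))) u)) (pi1 (pi2 x)) (pi2 (pi2 x)))"
      unfolding count_below_eq_rec_nat by (intro recursive_intros recursive_on_ev)
    then show "decidable_on {ind (jump (jump {}))}
        (\<lambda>_ x. Good (pi1 (pi1 x)) (pi2 (pi1 x)) (pi2 x))"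
      unfolding Good_def
      by (intro decidable_on_conj decidable_on_jump_all decidable_on_halts recursive_intros
          recursive_on_computable[OF t(1)] recursive_on_stage_index)
    show "recursive_on T (\<lambda>_ x. \<delta> (pi1 (pi1 x)) (pi2 (pi1 x)) (pi2 x))" for T
      unfolding \<delta>_def
      by (intro recursive_intros recursive_on_computable[OF s(1)] recursive_on_stage_index)
  next
    have "(\<exists>w. Good i g w) \<and>
        (\<forall>w. Good i g w \<longrightarrow> (\<exists>d. phi {} (\<delta> i g w) = (\<lambda>x. Some (d x)) \<and> thins c \<phi> M d))"
    if i: "phi {} i = (\<lambda>x. Some (c x))" and g: "phi {} g = (\<lambda>x. Some (\<phi> x))"
      and inj: "inj \<phi>" and M: "1 \<le> M" and fib: "\<And>j. 2 \<le> j \<Longrightarrow> card (c -` {j}) = M"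
    for i g c \<phi> M
    proof -
      define q where "q = (\<lambda>x. c (\<phi> x))"
      define f where "f w x = prod_encode (prod_encode (c x, \<phi> x), w)" for w x
      have fs: "cf (f w) = c" "qf (f w) = q" "kf (f w) = pi1 w" "Nf (f w) = pi2 w" for w
        by (auto simp: fun_eq_iff cf_def qf_def kf_def Nf_def f_def q_def)
      have ix: "phi {} (stage_index i g w) = (\<lambda>x. Some (f w x))" for w
        unfolding f_def by (rule phi_stage_index[OF i g])
      have q': "(\<lambda>x. ev i (ev g x)) = q" by (simp add: q_def ev_eq[OF i] ev_eq[OF g])
      have Good: "Good i g w \<longleftrightarrow> (\<forall>n. \<exists>m. large_fibre q (pi1 w) n m) \<and>
          (\<forall>j b. pi2 w < j \<longrightarrow> count_below q j b \<le> pi1 w)" for w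
        unfolding Good_def t(2)[OF UNIV_I ix] fs q'
        using all_nat_pair_iff[of "\<lambda>j b. pi2 w < j \<longrightarrow> count_below q j b \<le> pi1 w"] by blast
      obtain k N where kN: "\<forall>n. \<exists>m. large_fibre q k n m"
          "\<forall>j b. N < j \<longrightarrow> count_below q j b \<le> k"
        using thinning_parameters_exist[OF fibre_q[OF q_def inj M fib]] by blast
      then have "Good i g (prod_encode (k, N))" unfolding Good by simp
      moreover have "\<exists>d. phi {} (\<delta> i g w) = (\<lambda>x. Some (d x)) \<and> thins c \<phi> M d"
        if "Good i g w" for w
      proof -
        have large: "\<exists>m. large_fibre q (pi1 w) n m"
          and bound: "pi2 w < j \<Longrightarrow> count_below q j b \<le> pi1 w" for n j b
          using that unfolding Good by blast+
        have "f w \<in> S"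
          unfolding S_def mem_Collect_eq fs
          using ex_coordinate_2[OF q_def inj M fib] ex_escaping[OF q_def inj M fib] large by blast
        from s(2)[OF this ix] show ?thesis
          unfolding \<delta>_def fs zf_def using thins_thinning[OF q_def inj M fib large bound] by blast
      qed
      ultimately show ?thesis by blast
    qed
    then show "\<forall>i g c \<phi> M. phi {} i = (\<lambda>x. Some (c x)) \<longrightarrow> phi {} g = (\<lambda>x. Some (\<phi> x)) \<longrightarrow>
        inj \<phi> \<longrightarrow> 1 \<le> M \<longrightarrow> (\<forall>j\<ge>2. card (c -` {j}) = M) \<longrightarrow>
        (\<exists>w. Good i g w) \<and>
        (\<forall>w. Good i g w \<longrightarrow> (\<exists>d. phi {} (\<delta> i g w) = (\<lambda>x. Some (d x)) \<and> thins c \<phi> M d))"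
      by simp
  qed
qed

section \<open>The tower\<close>

primrec iterate_from :: "(nat \<Rightarrow> nat \<Rightarrow> nat) \<Rightarrow> nat \<Rightarrow> nat \<Rightarrow> nat \<Rightarrow> nat" where
  "iterate_from d 0 e j = j"
| "iterate_from d (Suc n) e j = iterate_from d n (Suc e) (d e j)"

text \<open>The colour of \<open>j\<close> at level \<open>e\<close> is found by applying the maps
  \<open>d e\<close>, \<open>d (Suc e)\<close> and so on. In the intended setting all of them fix 1,
  so reaching it is permanent.\<close>

definition tower :: "(nat \<Rightarrow> nat \<Rightarrow> nat) \<Rightarrow> nat \<Rightarrow> nat set" where
  "tower d e = {j. \<exists>n. iterate_from d n e j = 1}"

context
  fixes d c :: "nat \<Rightarrow> nat \<Rightarrow> nat"
  assumes d0: "\<And>e. d e 0 = 0" and d1: "\<And>e. d e 1 = 1" and d_less: "\<forall>e. \<forall>j\<ge>2. d e j < j"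
    and c0: "\<And>x. c 0 x = x" and c_Suc: "\<And>e x. c (Suc e) x = d e (c e x)"
begin

lemma zero_notin_tower: "0 \<notin> tower d e"
proof -
  have "iterate_from d n e 0 = 0" for n by (induction n arbitrary: e) (simp_all add: d0)
  then show ?thesis by (simp add: tower_def)
qed

lemma one_in_tower: "1 \<in> tower d e"
  unfolding tower_def by (rule CollectI, rule exI[of _ 0]) simp

lemma mem_tower_iff_if_le_1: "j \<le> 1 \<Longrightarrow> j \<in> tower d e \<longleftrightarrow> j = 1"
  using zero_notin_tower[of e] one_in_tower[of e] by (cases j) auto

lemma tower_vimage: "tower d e = d e -` tower d (Suc e)"
proof (intro equalityI subsetI)
  fix j assume "j \<in> tower d e"
  then obtain n where n: "iterate_from d n e j = 1" by (auto simp: tower_def)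
  show "j \<in> d e -` tower d (Suc e)"
  proof (cases n)
    case 0
    then have "j = 1" using n by simp
    then show ?thesis by (simp only: vimage_eq d1 one_in_tower)
  next
    case (Suc m)
    then show ?thesis using n by (auto simp: tower_def)
  qed
next
  fix j assume "j \<in> d e -` tower d (Suc e)"
  then obtain n where "iterate_from d n (Suc e) (d e j) = 1" by (auto simp: tower_def)
  then show "j \<in> tower d e" unfolding tower_def by (intro CollectI exI[of _ "Suc n"]) simp
qed

lemma tower_0_vimage: "tower d 0 = c e -` tower d e"
proof (induction e)
  case (Suc e)
  also have "c e -` tower d e = c (Suc e) -` tower d (Suc e)"
    unfolding tower_vimage[of e] by (auto simp: c_Suc)
  finally show ?case .
qed (simp add: c0)

text \<open>Each stage lowers an uncoloured coordinate by at least one, so the colour of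
  \<open>x\<close> is settled after \<open>x\<close> stages. This bounds the existential quantifier
  in \<open>tower\<close>.\<close>

lemma mem_tower_0_iff: "x \<in> tower d 0 \<longleftrightarrow> c x x = 1"
proof -
  have "c n x \<le> 1 \<or> c n x + n \<le> x" for n
  proof (induction n)
    case (Suc n)
    consider "c n x = 0" | "c n x = 1" | "2 \<le> c n x" by linarith
    then show ?case
    proof cases
      case 3
      then show ?thesis using Suc d_less[rule_format, of "c n x" n] unfolding c_Suc by linarith
    next
      case 1
      then show ?thesis unfolding c_Suc by (simp only: d0) simp
    next
      case 2
      then show ?thesis unfolding c_Suc by (simp only: d1) simp
    qed
  qed (simp add: c0)
  from this[of x] have "c x x \<le> 1" by linarith
  then show ?thesis using tower_0_vimage[of x] mem_tower_iff_if_le_1 by auto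
qed

end

lemma card_merge_fibre:
  fixes a b :: "nat \<Rightarrow> nat"
  assumes "finite (a -` {j})" "finite (b -` {j})"
  shows "card ((\<lambda>n :: nat. if n mod 2 = 0 then a (n div 2) else b (n div 2)) -` {j}) =
    card (a -` {j}) + card (b -` {j})"
proof -
  let ?h = "\<lambda>n :: nat. if n mod 2 = 0 then a (n div 2) else b (n div 2)"
  have "?h -` {j} = (\<lambda>x. 2 * x) ` (a -` {j}) \<union> (\<lambda>x. 2 * x + 1) ` (b -` {j})"
  proof (intro equalityI subsetI)
    fix n assume n: "n \<in> ?h -` {j}"
    show "n \<in> (\<lambda>x. 2 * x) ` (a -` {j}) \<union> (\<lambda>x. 2 * x + 1) ` (b -` {j})"
    proof (cases "n mod 2 = 0")
      case True
      then have "n = 2 * (n div 2)" by presburger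
      then show ?thesis using n True by (intro UnI1 image_eqI[of _ _ "n div 2"]) simp_all
    next
      case False
      then have "n = 2 * (n div 2) + 1" by presburger
      then show ?thesis using n False by (intro UnI2 image_eqI[of _ _ "n div 2"]) simp_all
    qed
  qed auto
  also have "card \<dots> = card ((\<lambda>x. 2 * x) ` (a -` {j})) + card ((\<lambda>x. 2 * x + 1) ` (b -` {j}))"
  proof (rule card_Un_disjoint)
    have "2 * x \<noteq> 2 * y + 1" for x y :: nat by presburger
    then show "(\<lambda>x. 2 * x) ` (a -` {j}) \<inter> (\<lambda>x. 2 * x + 1) ` (b -` {j}) = {}" by auto
  qed (use assms in auto)
  also have "\<dots> = card (a -` {j}) + card (b -` {j})"
    by (simp add: card_image inj_on_def)
  finally show ?thesis .
qed

lemma computableI: "phi {} i = (\<lambda>x. Some (f x)) \<Longrightarrow> computable f"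
  unfolding computable_in_def by blast

theorem theorem3p3:
  "\<exists>(U :: nat set) (Us :: nat \<Rightarrow> nat set).
     U \<le>\<^sub>T jump (jump {}) \<and>
     Us 0 = U \<and> weak_dyadic_tower Us \<and>
     \<not> computable_set U \<and> \<not> is_cylinder U \<and>
     (\<forall>e. computable_reservoirs (Us e)) \<and>
     base_absorption U Us \<and>
     (\<exists>F :: nat \<Rightarrow> nat \<Rightarrow> nat.
        computable_list_in (jump (jump {})) F \<and>
        (\<forall>e. computable (F e) \<and> inj (F e)) \<and>
        (\<forall>f. computable f \<and> inj f \<longrightarrow> (\<exists>e. F e = f)) \<and>
        (\<forall>e. \<exists>k \<in> {0..2 ^ e}. U \<oplus> (F e -` U) \<equiv>\<^sub>1 autojoin (2 ^ e + k) (Us e)))"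
proof -
  let ?J = "{ind (jump (jump {}))}"
  obtain Good \<delta> where Good: "decidable_on ?J (\<lambda>_ x. Good (pi1 (pi1 x)) (pi2 (pi1 x)) (pi2 x))"
    and \<delta>: "\<And>S. recursive_on S (\<lambda>_ x. \<delta> (pi1 (pi1 x)) (pi2 (pi1 x)) (pi2 x))"
    and stage: "\<forall>i g c \<phi> M. phi {} i = (\<lambda>x. Some (c x)) \<longrightarrow> phi {} g = (\<lambda>x. Some (\<phi> x)) \<longrightarrow>
      inj \<phi> \<longrightarrow> 1 \<le> M \<longrightarrow> (\<forall>j\<ge>2. card (c -` {j}) = M) \<longrightarrow>
      (\<exists>w. Good i g w) \<and>
      (\<forall>w. Good i g w \<longrightarrow> (\<exists>d. phi {} (\<delta> i g w) = (\<lambda>x. Some (d x)) \<and> thins c \<phi> M d))"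
    by (rule thinning_stage) (rule that)

  \<comment> \<open>A list of all computable injections\<close>
  define i0 where "i0 = prog_index id_prog"
  have phi_i0: "phi {} i0 = (\<lambda>x. Some x)" by (simp add: i0_def run_eq_runf fun_eq_iff)
  \<comment> \<open>Totality and, through \<open>ev\<close>, injectivity are universal statements
    over conditions decidable from the first jump, so \<open>T\<close> is decidable from the
    second.\<close>
  define T where "T e \<longleftrightarrow> (\<forall>x. phi {} e x \<noteq> None) \<and>
    (\<forall>m. pi1 m \<noteq> pi2 m \<longrightarrow> ev e (pi1 m) \<noteq> ev e (pi2 m))" for e
  \<comment> \<open>Invalid indices are replaced by the identity. The shift by one reserves entry 0
    for the identity, since the map \<open>d e\<close> is built to handle entry \<open>Suc e\<close>
    and no map precedes level 0.\<close>
  define g where "g e = (if e = 0 then i0 else if T (e - 1) then e - 1 else i0)" for e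
  define F where "F e = ev (g e)" for e

  have inj_ev: "inj (ev e)" if "T e" for e
    using that all_nat_pair_iff[of "\<lambda>a b. a \<noteq> b \<longrightarrow> ev e a \<noteq> ev e b"]
    unfolding T_def inj_def by blast
  have phi_ev: "phi {} e = (\<lambda>x. Some (ev e x))" if "T e" for e
    using that unfolding T_def ev_def by (auto simp: fun_eq_iff split: option.split)
  have ev_i0: "ev i0 = (\<lambda>x. x)" by (simp add: fun_eq_iff ev_eq[OF phi_i0])
  have phi_g: "phi {} (g e) = (\<lambda>x. Some (F e x))" for e
    using phi_ev[of "e - 1"] by (simp add: F_def g_def ev_i0 phi_i0)
  have inj_F: "inj (F e)" for e
    using inj_ev[of "e - 1"] by (simp add: F_def g_def ev_i0)
  have F_surj: "\<exists>e. F (Suc e) = f" if f: "computable f" "inj f" for f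
  proof -
    obtain e where e: "phi {} e = (\<lambda>x. Some (f x))" using f(1) by (auto simp: computable_in_def)
    have "T e" unfolding T_def using e injD[OF f(2)] by (auto simp: ev_eq[OF e])
    then have "F (Suc e) = f" by (simp add: F_def g_def fun_eq_iff ev_eq[OF e])
    then show ?thesis by blast
  qed

  have T_rec: "decidable_on ?J (\<lambda>_. T)"
    unfolding T_def
    by (intro decidable_on_conj decidable_on_jump_all decidable_on_halts recursive_intros
        recursive_on_ev)
  have g_rec: "recursive_on ?J (\<lambda>_. g)"
    unfolding g_def by (intro recursive_intros decidable_on_comp[OF T_rec])

  \<comment> \<open>The recursion on stages\<close>
  define st where "st = rec_nat i0 (\<lambda>n s. 6 + 4 * prod_encode
    (\<delta> s (g (Suc n)) (LEAST w. Good s (g (Suc n)) w), s))"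
  define w where "w e = (LEAST w. Good (st e) (g (Suc e)) w)" for e
  define c where "c e = ev (st e)" for e
  define d where "d e = ev (\<delta> (st e) (g (Suc e)) (w e))" for e
  have st_0: "st 0 = i0" by (simp add: st_def)
  have st_Suc: "st (Suc e) = 6 + 4 * prod_encode (\<delta> (st e) (g (Suc e)) (w e), st e)" for e
    by (simp add: st_def w_def)
  \<comment> \<open>A stage works only if \<open>st e\<close> is an index of \<open>c e\<close> and
    the fibres of \<open>c e\<close> have size \<open>2 ^ e\<close>; these invariants are assumed
    here and established by induction in \<open>inv\<close>.\<close>
  have step: "(\<exists>w. Good (st e) (g (Suc e)) w) \<and>
      phi {} (\<delta> (st e) (g (Suc e)) (w e)) = (\<lambda>x. Some (d e x)) \<and>
      thins (c e) (F (Suc e)) (2 ^ e) (d e)"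
    if "phi {} (st e) = (\<lambda>x. Some (c e x))" "\<And>j. 2 \<le> j \<Longrightarrow> card (c e -` {j}) = 2 ^ e" for e
  proof -
    have s: "(\<exists>w. Good (st e) (g (Suc e)) w) \<and> (\<forall>w. Good (st e) (g (Suc e)) w \<longrightarrow>
        (\<exists>d'. phi {} (\<delta> (st e) (g (Suc e)) w) = (\<lambda>x. Some (d' x)) \<and>
          thins (c e) (F (Suc e)) (2 ^ e) d'))"
      using stage[rule_format, OF that(1) phi_g inj_F _ that(2)] by simp
    then have ex: "\<exists>w. Good (st e) (g (Suc e)) w" by blast
    then have "Good (st e) (g (Suc e)) (w e)" unfolding w_def by (rule LeastI_ex)
    then obtain d' where d': "phi {} (\<delta> (st e) (g (Suc e)) (w e)) = (\<lambda>x. Some (d' x))"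
        "thins (c e) (F (Suc e)) (2 ^ e) d'" using s by blast
    have "d' = d e" by (simp add: fun_eq_iff d_def ev_eq[OF d'(1)])
    with ex d' show ?thesis by blast
  qed
  have inv: "phi {} (st e) = (\<lambda>x. Some (c e x)) \<and> (\<forall>j\<ge>2. card (c e -` {j}) = 2 ^ e)" for e
  proof (induction e)
    case 0
    have "(\<lambda>x. x) -` {j} = {j}" for j :: nat by auto
    then show ?case by (simp add: c_def st_0 ev_i0 phi_i0)
  next
    case (Suc e)
    then have s: "phi {} (\<delta> (st e) (g (Suc e)) (w e)) = (\<lambda>x. Some (d e x))"
      "thins (c e) (F (Suc e)) (2 ^ e) (d e)" using step[of e] by blast+
    have ix: "phi {} (st (Suc e)) = (\<lambda>x. Some (d e (c e x)))"
      unfolding st_Suc using phi_comp_index[OF s(1)] Suc by blast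
    then have "c (Suc e) = (\<lambda>x. d e (c e x))" by (simp add: c_def fun_eq_iff ev_eq[OF ix])
    with ix s(2) show ?case unfolding thins_def by simp
  qed
  have ex_Good: "\<exists>w. Good (st e) (g (Suc e)) w"
    and phi_d: "phi {} (\<delta> (st e) (g (Suc e)) (w e)) = (\<lambda>x. Some (d e x))"
    and thins: "thins (c e) (F (Suc e)) (2 ^ e) (d e)" for e
    using step[of e] inv[of e] by blast+
  have c_0: "c 0 = (\<lambda>x. x)" by (simp add: c_def st_0 ev_i0)
  have c_Suc: "c (Suc e) x = d e (c e x)" for e x
  proof -
    have "phi {} (st (Suc e)) = (\<lambda>x. Some (d e (c e x)))"
      unfolding st_Suc using phi_comp_index[OF phi_d] inv by blast
    then show ?thesis by (simp add: c_def ev_eq)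
  qed
  have d: "d e 0 = 0" "d e 1 = 1" "\<forall>e. \<forall>j\<ge>2. d e j < j" for e
    using thins unfolding thins_def by blast+
  have c0: "c 0 x = x" for x by (simp add: c_0)
  note tower_facts = d c0 c_Suc

  \<comment> \<open>Properties of the tower\<close>
  define U where "U = tower d"
  note U_vimage = tower_vimage[of d c, OF tower_facts, folded U_def]
  note U0_vimage = tower_0_vimage[of d c, OF tower_facts, folded U_def]
  note U_01 = zero_notin_tower[of d c, OF tower_facts, folded U_def]
    one_in_tower[of d c, OF tower_facts, folded U_def]
  note U_le_1 = mem_tower_iff_if_le_1[of d c, OF tower_facts, folded U_def]
  have comp_c: "computable (c e)" and comp_d: "computable (d e)" and comp_F: "computable (F e)" for e
    using inv phi_d phi_g by (blast intro: computableI)+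

  have res: "computable_reservoirs (U e)" for e
  proof -
    have "computable_set {i}" for i
      unfolding computable_set_iff singleton_iff by (intro recursive_intros)
    then have "computable_reservoirs (d e -` U (Suc e))"
      using thins[of e] U_01[of "Suc e"] unfolding thins_def
      by (intro computable_reservoirs_vimage[of _ "{1}" "{0}"] comp_d) auto
    then show ?thesis using U_vimage[of e] by simp
  qed

  have tower: "U e \<equiv>\<^sub>1 autojoin 2 (U (Suc e))" for e
    using thins[of e] unfolding thins_def
    by (intro one_equiv_autojoin_if_fibres[OF comp_d U_vimage U_01 res res]) auto

  have absorb: "\<exists>k\<in>{0..2 ^ e}. U 0 \<oplus> (F e -` U 0) \<equiv>\<^sub>1 autojoin (2 ^ e + k) (U e)" for e
  proof -
    have "\<exists>k\<le>2 ^ e. \<forall>j\<ge>2. card ((\<lambda>x. c e (F e x)) -` {j}) = k"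
    proof (cases e)
      case 0
      have "(\<lambda>x. x) -` {j} = {j}" for j :: nat by auto
      \<comment> \<open>At level 0 both maps are the identity, so every fibre has size 1.\<close>
      then show ?thesis by (intro exI[of _ 1]) (simp add: 0 c_0 F_def g_def ev_i0)
    next
      case (Suc e')
      then show ?thesis using thins[of e'] unfolding thins_def by (simp add: c_Suc)
    qed
    then obtain k where k: "k \<le> 2 ^ e" "\<And>j. 2 \<le> j \<Longrightarrow> card ((\<lambda>x. c e (F e x)) -` {j}) = k"
      by blast
    \<comment> \<open>The even half pulls back \<open>U 0\<close> and the odd half its preimage
      under \<open>F e\<close>, both from level \<open>e\<close>; their fibre sizes
      \<open>2 ^ e\<close> and \<open>k\<close> add up.\<close>
    define h where "h n = (if n mod 2 = 0 then c e (n div 2) else c e (F e (n div 2)))" for n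
    have "computable h" unfolding h_def computable_in_iff
      by (intro recursive_intros recursive_on_computable[OF comp_c] recursive_on_computable[OF comp_F])
    moreover have "U 0 \<oplus> (F e -` U 0) = h -` U e"
      using U0_vimage[of e] by (auto simp: mem_join_iff h_def)
    moreover have "card (h -` {j}) = 2 ^ e + k" if j: "2 \<le> j" for j
    proof -
      have card: "card (c e -` {j}) = 2 ^ e" using inv j by blast
      then have fin: "finite (c e -` {j})" by (intro card_ge_0_finite) simp
      have "(\<lambda>x. c e (F e x)) -` {j} = F e -` (c e -` {j})" by auto
      then have "finite ((\<lambda>x. c e (F e x)) -` {j})" using finite_vimageI[OF fin inj_F] by simp
      from card_merge_fibre[OF fin this] show ?thesis
        unfolding h_def card k(2)[OF j] .
    qed
    moreover have "1 \<le> 2 ^ e + k" by (simp add: trans_le_add1)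
    ultimately have "U 0 \<oplus> (F e -` U 0) \<equiv>\<^sub>1 autojoin (2 ^ e + k) (U e)"
      by (intro one_equiv_autojoin_if_fibres[of h, OF _ _ U_01 computable_reservoirs_join[OF res] res])
    with k(1) show ?thesis by auto
  qed

  have not_cyl: "\<not> is_cylinder (U 0)"
  proof
    assume "is_cylinder (U 0)"
    then have "Cyl (U 0) \<le>\<^sub>1 U 0" by (simp add: is_cylinder_def one_equiv_def)
    then obtain f where f: "computable f" "inj f" "\<And>x. x \<in> Cyl (U 0) \<longleftrightarrow> f x \<in> U 0"
      by (auto simp: one_le_def)
    obtain e where F: "F (Suc e) = f" using F_surj[OF f(1,2)] by blast
    \<comment> \<open>Stage \<open>e\<close> has given \<open>x\<close> and the image of a point in
      its column different final colours, whereas a reduction of the cylinder would make them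
      agree.\<close>
    obtain x t where xt: "d e (c e x) \<le> 1" "d e (c e (f (prod_encode (x, t)))) \<le> 1"
        "d e (c e x) \<noteq> d e (c e (f (prod_encode (x, t))))"
      using thins[of e] unfolding thins_def F by blast
    have mem: "u \<in> U 0 \<longleftrightarrow> d e (c e u) = 1" if "d e (c e u) \<le> 1" for u
      using U0_vimage[of "Suc e"] U_le_1[OF that, of "Suc e"] by (simp add: c_Suc)
    have "x \<in> U 0 \<longleftrightarrow> f (prod_encode (x, t)) \<in> U 0"
      using f(3)[of "prod_encode (x, t)"] by (simp add: mem_Cyl_iff)
    then have "d e (c e x) = 1 \<longleftrightarrow> d e (c e (f (prod_encode (x, t)))) = 1"
      using mem xt by blast
    with xt show False by linarith
  qed

  \<comment> \<open>Computability from the second jump and conclusion\<close>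
  have "recursive_on ?J (\<lambda>_. st)"
  proof (rule recursive_on_search_rec[where P = "\<lambda>y w. Good (pi2 y) (g (Suc (pi1 y))) w"
        and H = "\<lambda>y w. 6 + 4 * prod_encode (\<delta> (pi2 y) (g (Suc (pi1 y))) w, pi2 y)"])
    have arg: "recursive_on ?J (\<lambda>_ x. prod_encode (prod_encode
        (pi2 (pi1 x), g (Suc (pi1 (pi1 x)))), pi2 x))"
      by (intro recursive_intros recursive_on_comp[OF g_rec])
    show "decidable_on ?J (\<lambda>_ x. Good (pi2 (pi1 x)) (g (Suc (pi1 (pi1 x)))) (pi2 x))"
      using decidable_on_comp[OF Good arg] by simp
    have "recursive_on ?J (\<lambda>_ x. \<delta> (pi2 (pi1 x)) (g (Suc (pi1 (pi1 x)))) (pi2 x))"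
      using recursive_on_comp[OF \<delta> arg] by simp
    then show "recursive_on ?J (\<lambda>_ x. 6 + 4 * prod_encode
        (\<delta> (pi2 (pi1 x)) (g (Suc (pi1 (pi1 x)))) (pi2 x), pi2 (pi1 x)))"
      by (intro recursive_intros)
  qed (use ex_Good in \<open>simp_all add: st_Suc w_def\<close>)
  moreover have "recursive_on ?J (\<lambda>_ x. ev (pi1 x) (pi2 x))"
    by (intro recursive_on_jump recursive_on_ev recursive_intros)
  ultimately have "recursive_on ?J (\<lambda>_ x. c x x)"
    unfolding c_def using recursive_on_lift2[of ?J "\<lambda>_. ev" "\<lambda>_. st" "\<lambda>_ x. x"]
    by (simp add: recursive_on_id)
  then have "decidable_on ?J (\<lambda>_ x. x \<in> U 0)"
    unfolding U_def mem_tower_0_iff[of d c, OF tower_facts]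
    by (intro decidable_on_eq recursive_on_const)
  then have "U 0 \<le>\<^sub>T jump (jump {})" by (simp only: turing_le_iff)
  moreover have "weak_dyadic_tower U" using tower by (simp add: weak_dyadic_tower_def)
  moreover have "\<not> computable_set (U 0)" using is_cylinder_if_computable_set[OF _ res] not_cyl by blast
  moreover have "base_absorption (U 0) U"
    unfolding base_absorption_def
  proof (intro allI impI)
    fix X assume "X \<le>\<^sub>1 U 0"
    then obtain f where f: "computable f" "inj f" "X = f -` U 0" by (auto simp: one_le_def)
    obtain e where "F e = f" using F_surj[OF f(1,2)] by blast
    then obtain k where "U 0 \<oplus> X \<equiv>\<^sub>1 autojoin (2 ^ e + k) (U e)" using absorb[of e] f(3) by blast
    then show "\<exists>e m. 1 \<le> m \<and> U 0 \<oplus> X \<equiv>\<^sub>1 autojoin m (U e)"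
      by (intro exI[of _ e] exI[of _ "2 ^ e + k"]) (simp add: trans_le_add1)
  qed
  moreover have "computable_list_in (jump (jump {})) F"
    unfolding computable_list_in_def using g_rec phi_g by (auto simp only: computable_in_iff)
  ultimately show ?thesis
    using not_cyl res comp_F inj_F F_surj absorb
    by (intro exI[of _ "U 0"] exI[of _ U] conjI exI[of _ F] allI impI) blast+
qed

end
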